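(* The uniformly random graph on vertex set $\{1,\dots,n\}$ is $TT$-rigid with probability tending to $1$ as $n\to\infty$. Moreover, there are $$\frac1{n!}\binom{\binom n2}{\lfloor\frac12\binom n2\rfloor}(1-o(1))$$ pairwise $TT$-incomparable $TT$-rigid graphs on $n$ vertices; that is, there is a sequence $\varepsilon_n\to0$ such that for each $n$ there is a family of at least $\frac1{n!}\binom{\binom n2}{\lfloor\frac12\binom n2\rfloor}(1-\varepsilon_n)$ graphs on $n$ vertices, each $TT$-rigid, with any two distinct members $TT$-incomparable.
   Context: Graphs are finite, undirected, simple and loopless. A cut in a graph $G=(V,E)$ is the set of all edges with one end in $X$ and the other in $V\setminus X$, for some $X\subseteq V$ (so the empty set is a cut). A mapping $f:E(G)\to E(H)$ is cut-continuous (also called a $TT$ mapping, over the group $\mathbb Z_2$) if for every cut $C$ of $H$ the preimage $f^{-1}(C)$ is a cut of $G$. A graph $G$ is $TT$-rigid if the only cut-continuous mapping $E(G)\to E(G)$ is the identity. Graphs $G,H$ are $TT$-incomparable if there is no cut-continuous mapping $E(G)\to E(H)$ and none $E(H)\to E(G)$. *)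

theory Defs
  imports "HOL-Probability.Probability"
begin

type_synonym 'a graph = "'a set \<times> 'a set set"

abbreviation verts :: "'a graph \<Rightarrow> 'a set" where
  "verts \<equiv> fst"

abbreviation edges :: "'a graph \<Rightarrow> 'a set set" where
  "edges \<equiv> snd"

definition simple_graph :: "'a graph \<Rightarrow> bool" where
  "simple_graph G \<longleftrightarrow> finite (verts G) \<and> (\<forall>e\<in>edges G. e \<subseteq> verts G \<and> card e = 2)"

definition edge_cut :: "'a graph \<Rightarrow> 'a set \<Rightarrow> 'a set set" where
  "edge_cut G X = {e \<in> edges G. \<exists>x y. e = {x, y} \<and> x \<in> X \<and> y \<in> verts G - X}"

definition is_cut :: "'a graph \<Rightarrow> 'a set set \<Rightarrow> bool" where
  "is_cut G C \<longleftrightarrow> (\<exists>X. X \<subseteq> verts G \<and> C = edge_cut G X)"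

text \<open>A mapping between edge sets is a total function, of which only the values on
  \<^term>\<open>edges G\<close> matter; hence the preimage is restricted to \<^term>\<open>edges G\<close>, and
  being the identity is only required there.\<close>

definition cut_continuous :: "'a graph \<Rightarrow> 'b graph \<Rightarrow> ('a set \<Rightarrow> 'b set) \<Rightarrow> bool" where
  "cut_continuous G H f \<longleftrightarrow>
     f \<in> edges G \<rightarrow> edges H \<and> (\<forall>C. is_cut H C \<longrightarrow> is_cut G (f -` C \<inter> edges G))"

definition TT_rigid :: "'a graph \<Rightarrow> bool" where
  "TT_rigid G \<longleftrightarrow> (\<forall>f. cut_continuous G G f \<longrightarrow> (\<forall>e\<in>edges G. f e = e))"

definition TT_incomparable :: "'a graph \<Rightarrow> 'b graph \<Rightarrow> bool" where
  "TT_incomparable G H \<longleftrightarrow> (\<nexists>f. cut_continuous G H f) \<and> (\<nexists>f. cut_continuous H G f)"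

definition graphs_on :: "nat \<Rightarrow> nat graph set" where
  "graphs_on n = {G. simple_graph G \<and> verts G = {1..n}}"

lemma graphs_on_eq: "graphs_on n = {{1..n}} \<times> Pow {e. e \<subseteq> {1..n} \<and> card e = 2}"
proof -
  have "G \<in> graphs_on n \<longleftrightarrow> verts G = {1..n} \<and> edges G \<subseteq> {e. e \<subseteq> {1..n} \<and> card e = 2}" for G
    unfolding graphs_on_def simple_graph_def mem_Collect_eq using finite_atLeastAtMost[of 1 n] by auto
  then show ?thesis
    by (simp add: set_eq_iff mem_Times_iff)
qed

lemma finite_graphs_on: "finite (graphs_on n)"
  by (simp add: graphs_on_eq)

lemma graphs_on_nonempty: "graphs_on n \<noteq> {}"
  by (auto simp: graphs_on_eq)

lemma card_graphs_on: "card (graphs_on n) = 2 ^ (n choose 2)"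
  by (simp add: graphs_on_eq card_cartesian_product card_Pow n_subsets)

definition random_graph :: "nat \<Rightarrow> nat graph pmf" where
  "random_graph n = pmf_of_set (graphs_on n)"

end

theory Submission
  imports Defs "HOL-Real_Asymp.Real_Asymp"
begin

text \<open>A cut-continuous map sends triangles to triangles: by considering the cuts around single
  vertices, every vertex lies on an even number of the images of the three edges. If moreover any
  five vertices of the source have a common neighbour, the images of the edges at a vertex \<open>v\<close> all
  share a vertex \<open>g v\<close>, so the map is induced by a homomorphism \<open>g\<close>.

  Let both graphs be typical random graphs on \<open>n\<close> vertices. If \<open>g u = g v\<close> for some \<open>u \<noteq> v\<close>, then
  the roughly \<open>3n/4\<close> neighbours of \<open>u\<close> or \<open>v\<close> are mapped into the roughly \<open>n/2\<close> neighbours of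
  \<open>g u\<close>. Hence \<open>g\<close> identifies the members of about \<open>sqrt n\<close> disjoint pairs. Most pairs of these
  pairs are joined by an edge, and this forces the image to be denser than a random graph is. So \<open>g\<close>
  is injective, and an isomorphism if the numbers of edges agree. An automorphism moving \<open>v\<close> to
  \<open>w \<noteq> v\<close> moves every neighbour of \<open>v\<close> that is not a neighbour of \<open>w\<close>, which yields two
  disjoint identical copies of a subgraph on about \<open>sqrt n\<close> vertices.

  Exceptional graphs form a fraction \<open>o(1/n\<^sup>2)\<close> of all graphs, whereas the graphs with
  \<open>\<lfloor>N/2\<rfloor>\<close> of the \<open>N\<close> possible edges form a fraction of at least \<open>1/(N+1)\<close>. Taking one typical
  graph with \<open>\<lfloor>N/2\<rfloor>\<close> edges from each isomorphism class gives the incomparable family.\<close>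

subsection \<open>Cut-continuous maps and homomorphisms\<close>

lemma card_2_obtain_other:
  assumes "card p = 2" "x \<in> p"
  obtains y where "p = {x, y}" "x \<noteq> y"
proof -
  obtain a b where ab: "p = {a, b}" "a \<noteq> b"
    using assms(1) by (meson card_2_iff)
  show thesis
  proof (cases "x = a")
    case True
    then show thesis
      using ab that by blast
  next
    case False
    then show thesis
      using ab assms(2) that[of a] by blast
  qed
qed

lemma simple_graph_edgeD:
  assumes "simple_graph G" "{a, b} \<in> edges G"
  shows "a \<in> verts G" "b \<in> verts G" "a \<noteq> b"
proof -
  have "\<forall>e\<in>edges G. e \<subseteq> verts G \<and> card e = 2"
    using assms(1) unfolding simple_graph_def ..
  from bspec[OF this assms(2)] have "{a, b} \<subseteq> verts G" "card {a, b} = 2"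
    by simp_all
  then show "a \<in> verts G" "b \<in> verts G" "a \<noteq> b"
    by auto
qed

lemma mem_edge_cut_iff:
  assumes "simple_graph G" "{a, b} \<in> edges G"
  shows "{a, b} \<in> edge_cut G X \<longleftrightarrow> (a \<in> X) \<noteq> (b \<in> X)"
  using assms(2) simple_graph_edgeD[OF assms] unfolding edge_cut_def mem_Collect_eq doubleton_eq_iff
  by blast

lemma edge_cut_singleton:
  assumes "simple_graph H" "w \<in> verts H"
  shows "edge_cut H {w} = {e \<in> edges H. w \<in> e}"
proof -
  have "\<exists>y. e = {w, y} \<and> y \<in> verts H - {w}" if e: "e \<in> edges H" "w \<in> e" for e
  proof -
    have "card e = 2"
      using assms(1) e(1) unfolding simple_graph_def by blast
    from this e(2) obtain y where y: "e = {w, y}" "w \<noteq> y"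
      by (rule card_2_obtain_other)
    then have "y \<in> verts H"
      using simple_graph_edgeD(2)[OF assms(1)] e(1) by blast
    with y show ?thesis
      by blast
  qed
  then show ?thesis
    unfolding edge_cut_def by blast
qed

text \<open>The preimage of the cut around \<open>w\<close> is the cut of some vertex set
  \<open>X\<close>, so \<open>w\<close> lies on the image of an edge exactly when \<open>X\<close>
  separates its ends. A set separates an even number of the three pairs among \<open>a\<close>,
  \<open>b\<close>, \<open>c\<close>. For \<open>w\<close> outside \<open>verts H\<close> all three
  memberships fail.\<close>

lemma cut_continuous_triangle:
  assumes G: "simple_graph G" and H: "simple_graph H" and f: "cut_continuous G H f"
    and tri: "{a, b} \<in> edges G" "{a, c} \<in> edges G" "{b, c} \<in> edges G"
  shows "w \<in> f {b, c} \<longleftrightarrow> (w \<in> f {a, b}) \<noteq> (w \<in> f {a, c})"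
proof (cases "w \<in> verts H")
  case True
  have fE: "f e \<in> edges H" if "e \<in> edges G" for e
    using f that unfolding cut_continuous_def by blast
  have "is_cut H {e \<in> edges H. w \<in> e}"
    unfolding is_cut_def using edge_cut_singleton[OF H True, symmetric] True
    by (intro exI[of _ "{w}"]) simp
  then have "is_cut G (f -` {e \<in> edges H. w \<in> e} \<inter> edges G)"
    using f unfolding cut_continuous_def by blast
  then obtain X where X: "f -` {e \<in> edges H. w \<in> e} \<inter> edges G = edge_cut G X"
    unfolding is_cut_def by blast
  have mem: "w \<in> f {x, y} \<longleftrightarrow> (x \<in> X) \<noteq> (y \<in> X)" if xy: "{x, y} \<in> edges G" for x y
  proof -
    have "w \<in> f {x, y} \<longleftrightarrow> {x, y} \<in> f -` {e \<in> edges H. w \<in> e} \<inter> edges G"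
      using fE[OF xy] xy by simp
    then show ?thesis
      unfolding X mem_edge_cut_iff[OF G xy] .
  qed
  show ?thesis
    unfolding mem[OF tri(1)] mem[OF tri(2)] mem[OF tri(3)] by blast
next
  case False
  have "w \<notin> f e" if "e \<in> edges G" for e
    using False H f that unfolding cut_continuous_def simple_graph_def by blast
  then show ?thesis
    using tri by blast
qed

text \<open>The image of the third edge is the symmetric difference of the other two images. It
  would be empty if these were equal and have four elements if they were disjoint, but it has
  two.\<close>

lemma cut_continuous_triangle_edges:
  assumes G: "simple_graph G" and H: "simple_graph H" and f: "cut_continuous G H f"
    and tri: "{a, b} \<in> edges G" "{a, c} \<in> edges G" "{b, c} \<in> edges G"
  shows "f {a, b} \<noteq> f {a, c}" "f {a, b} \<inter> f {a, c} \<noteq> {}"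
proof -
  have two: "card (f e) = 2" if "e \<in> edges G" for e
    using H f that unfolding cut_continuous_def simple_graph_def by blast
  have eq: "f {b, c} = (f {a, b} - f {a, c}) \<union> (f {a, c} - f {a, b})"
    using cut_continuous_triangle[OF G H f tri] by blast
  show "f {a, b} \<noteq> f {a, c}"
    using eq two[OF tri(3)] by auto
  show "f {a, b} \<inter> f {a, c} \<noteq> {}"
  proof
    assume disj: "f {a, b} \<inter> f {a, c} = {}"
    then have "f {b, c} = f {a, b} \<union> f {a, c}"
      using eq by blast
    moreover have "finite (f {a, b})" "finite (f {a, c})"
      using two tri by (metis card.infinite zero_neq_numeral)+
    ultimately show False
      using two[OF tri(1)] two[OF tri(2)] two[OF tri(3)] card_Un_disjoint[OF _ _ disj] by simp
  qed
qed

text \<open>Three pairwise meeting edges form a star or a triangle; no further edge meets all edges of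
  a triangle.\<close>

lemma four_meeting_edges_star:
  assumes card: "card p = 2" "card q = 2" "card r = 2" "card s = 2"
    and ne: "p \<noteq> q" "p \<noteq> r" "p \<noteq> s" "q \<noteq> r" "q \<noteq> s" "r \<noteq> s"
    and meet: "p \<inter> q \<noteq> {}" "p \<inter> r \<noteq> {}" "p \<inter> s \<noteq> {}" "q \<inter> r \<noteq> {}" "q \<inter> s \<noteq> {}" "r \<inter> s \<noteq> {}"
    and x: "x \<in> p" "x \<in> q"
  shows "x \<in> r"
proof (rule ccontr)
  assume xr: "x \<notin> r"
  from card(1) x(1) obtain y where p: "p = {x, y}" "x \<noteq> y"
    by (rule card_2_obtain_other)
  from card(2) x(2) obtain z where q: "q = {x, z}" "x \<noteq> z"
    by (rule card_2_obtain_other)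
  have yr: "y \<in> r"
    using meet(2) xr by (simp add: p(1))
  have zr: "z \<in> r"
    using meet(4) xr by (simp add: q(1))
  have yz: "y \<noteq> z"
    using ne(1) p(1) q(1) by blast
  from card(3) yr obtain z' where "r = {y, z'}"
    by (rule card_2_obtain_other)
  then have r: "r = {y, z}"
    using zr yz by simp
  have "{x, y} \<subseteq> s \<or> {x, z} \<subseteq> s \<or> {y, z} \<subseteq> s"
    using meet(3,5,6) unfolding p(1) q(1) r by blast
  moreover have "t = s" if "t \<subseteq> s" "card t = 2" for t
    using that card(4) card_ge_0_finite[of s] by (intro card_subset_eq) auto
  ultimately show False
    using ne(3,5,6) card(1-3) unfolding p(1) q(1) r by blast
qed

text \<open>The vertex \<open>g v\<close> is a common vertex of the images of all edges at
  \<open>v\<close>. In \<open>ext\<close> the list may repeat vertices, so padding gives a common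
  neighbour of any one to five vertices; as there are no loops, it differs from all of them.\<close>

lemma cut_continuous_induced:
  assumes G: "simple_graph G" and H: "simple_graph H" and f: "cut_continuous G H f"
    and ext: "\<And>xs. set xs \<subseteq> verts G \<Longrightarrow> length xs = 5 \<Longrightarrow> \<exists>x. \<forall>a\<in>set xs. {x, a} \<in> edges G"
  obtains g where "g \<in> verts G \<rightarrow> verts H"
    "\<And>u v. {u, v} \<in> edges G \<Longrightarrow> g u \<noteq> g v \<and> f {u, v} = {g u, g v}"
proof -
  have fE: "f e \<in> edges H" "card (f e) = 2" "f e \<subseteq> verts H" if "e \<in> edges G" for e
    using H f that unfolding cut_continuous_def simple_graph_def by blast+
  note vE = simple_graph_edgeD[OF G]
  note tri = cut_continuous_triangle_edges[OF G H f]
  \<comment> \<open>A fifth vertex \<open>e\<close> joined to \<open>v\<close>, \<open>b\<close>,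
    \<open>c\<close>, \<open>d\<close> provides four edges at \<open>v\<close> whose images are
    distinct and pairwise meet, as any two of these edges lie in a triangle.\<close>
  have star: "x \<in> f {v, d}"
    if K5: "{v, b} \<in> edges G" "{v, c} \<in> edges G" "{v, d} \<in> edges G" "{b, c} \<in> edges G"
      "{b, d} \<in> edges G" "{c, d} \<in> edges G" and x: "x \<in> f {v, b}" "x \<in> f {v, c}" for v b c d x
  proof -
    have "set [v, b, c, d, d] \<subseteq> verts G"
      using K5 vE by auto
    from ext[OF this] obtain e where "\<forall>a\<in>set [v, b, c, d, d]. {e, a} \<in> edges G"
      by auto
    then have e: "{v, e} \<in> edges G" "{b, e} \<in> edges G" "{c, e} \<in> edges G" "{d, e} \<in> edges G"
      by (auto simp: insert_commute)
    show ?thesis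
      using four_meeting_edges_star[OF fE(2)[OF K5(1)] fE(2)[OF K5(2)] fE(2)[OF K5(3)] fE(2)[OF e(1)]
          tri(1)[OF K5(1,2,4)] tri(1)[OF K5(1,3,5)] tri(1)[OF K5(1) e(1,2)]
          tri(1)[OF K5(2,3,6)] tri(1)[OF K5(2) e(1,3)] tri(1)[OF K5(3) e(1,4)]
          tri(2)[OF K5(1,2,4)] tri(2)[OF K5(1,3,5)] tri(2)[OF K5(1) e(1,2)]
          tri(2)[OF K5(2,3,6)] tri(2)[OF K5(2) e(1,3)] tri(2)[OF K5(3) e(1,4)] x] .
  qed
  have ex: "\<exists>x\<in>verts H. \<forall>b. {v, b} \<in> edges G \<longrightarrow> x \<in> f {v, b}" if v: "v \<in> verts G" for v
  proof -
    have "set [v, v, v, v, v] \<subseteq> verts G"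
      using v by auto
    from ext[OF this] obtain b where b: "{v, b} \<in> edges G"
      by (auto simp: insert_commute)
    have "set [v, v, v, v, b] \<subseteq> verts G"
      using v vE[OF b] by auto
    from ext[OF this] obtain c where c: "{v, c} \<in> edges G" "{b, c} \<in> edges G"
      by (auto simp: insert_commute)
    obtain x where x: "x \<in> f {v, b}" "x \<in> f {v, c}"
      using tri[OF b c] by blast
    \<comment> \<open>The vertex \<open>b'\<close> may be adjacent to neither \<open>b\<close> nor
      \<open>c\<close>. Adjacent vertices \<open>d\<close> and \<open>e\<close>, each joined to
      \<open>v\<close>, \<open>b\<close>, \<open>c\<close> and \<open>b'\<close>, carry
      \<open>x\<close> over: first from \<open>b\<close>, \<open>c\<close> to \<open>d\<close> and
      to \<open>e\<close>, then from \<open>d\<close>, \<open>e\<close> to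
      \<open>b'\<close>.\<close>
    have "x \<in> f {v, b'}" if b': "{v, b'} \<in> edges G" for b'
    proof -
      have "set [v, v, b, c, b'] \<subseteq> verts G"
        using v vE[OF b] vE[OF c(1)] vE[OF b'] by auto
      from ext[OF this] obtain d where d: "{v, d} \<in> edges G" "{b, d} \<in> edges G" "{c, d} \<in> edges G"
        "{d, b'} \<in> edges G"
        by (auto simp: insert_commute)
      have "set [v, b, c, b', d] \<subseteq> verts G"
        using v vE[OF b] vE[OF c(1)] vE[OF b'] vE[OF d(1)] by auto
      from ext[OF this] obtain e where e: "{v, e} \<in> edges G" "{b, e} \<in> edges G" "{c, e} \<in> edges G"
        "{e, b'} \<in> edges G" "{d, e} \<in> edges G"
        by (auto simp: insert_commute)
      have "x \<in> f {v, d}"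
        using star[OF b c(1) d(1) c(2) d(2,3) x] .
      moreover have "x \<in> f {v, e}"
        using star[OF b c(1) e(1) c(2) e(2,3) x] .
      ultimately show ?thesis
        using star[OF d(1) e(1) b' e(5) d(4) e(4)] by blast
    qed
    moreover have "x \<in> verts H"
      using x fE b by blast
    ultimately show ?thesis
      by blast
  qed
  then obtain g where g: "\<And>v. v \<in> verts G \<Longrightarrow> g v \<in> verts H"
    "\<And>v b. v \<in> verts G \<Longrightarrow> {v, b} \<in> edges G \<Longrightarrow> g v \<in> f {v, b}"
    by metis
  show thesis
  proof (rule that[of g])
    show "g \<in> verts G \<rightarrow> verts H"
      using g by blast
    fix u v assume uv: "{u, v} \<in> edges G"
    have V: "u \<in> verts G" "v \<in> verts G"
      using vE[OF uv] by auto
    then have "set [u, u, u, u, v] \<subseteq> verts G"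
      by auto
    from ext[OF this] obtain w where w: "{u, w} \<in> edges G" "{v, w} \<in> edges G"
      by (auto simp: insert_commute)
    have "g u \<in> f {u, v}" "g u \<in> f {u, w}" "g v \<in> f {v, w}" "g v \<in> f {u, v}"
      using g(2)[OF V(1) uv] g(2)[OF V(1) w(1)] g(2)[OF V(2) w(2)] g(2)[OF V(2), of u] uv
      by (auto simp: insert_commute)
    \<comment> \<open>Since \<open>g u\<close> lies on the images of both \<open>{u, v}\<close> and
      \<open>{u, w}\<close>, it is not on that of \<open>{v, w}\<close>, whereas \<open>g v\<close>
      is.\<close>
    then have "g u \<noteq> g v" "{g u, g v} \<subseteq> f {u, v}"
      using cut_continuous_triangle[OF G H f uv w, of "g u"] by auto
    moreover from this have "{g u, g v} = f {u, v}"
      using fE(2)[OF uv] by (intro card_subset_eq) (auto intro: card_ge_0_finite)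
    ultimately show "g u \<noteq> g v \<and> f {u, v} = {g u, g v}"
      by simp
  qed
qed

subsection \<open>Tail bounds for random edge sets\<close>

lemma sum_Pow_disjoint_Un:
  assumes "finite A" "finite B" "A \<inter> B = {}"
  shows "(\<Sum>E\<in>Pow (A \<union> B). h E) = (\<Sum>D\<in>Pow A. \<Sum>E\<in>Pow B. h (D \<union> E))"
proof -
  have "bij_betw (\<lambda>(D, E). D \<union> E) (Pow A \<times> Pow B) (Pow (A \<union> B))"
    by (rule bij_betw_byWitness[where f' = "\<lambda>E. (E \<inter> A, E \<inter> B)"]) (use assms in auto)
  then show ?thesis
    by (simp add: sum.reindex_bij_betw[symmetric] sum.cartesian_product case_prod_beta)
qed

text \<open>The traces of a uniformly random subset of \<open>U\<close> on disjoint blocks are independent.\<close>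

lemma sum_Pow_prod_blocks:
  fixes w :: "'i \<Rightarrow> 'a set \<Rightarrow> real"
  assumes "finite U" "finite I" "\<And>i. i \<in> I \<Longrightarrow> B i \<subseteq> U" "disjoint_family_on B I"
  shows "(\<Sum>E\<in>Pow U. \<Prod>i\<in>I. w i (E \<inter> B i)) =
    2 ^ card U * (\<Prod>i\<in>I. (\<Sum>D\<in>Pow (B i). w i D) / 2 ^ card (B i))"
  using assms(2,1,3,4)
proof (induction I arbitrary: U rule: finite_induct)
  case empty
  then show ?case by (simp add: card_Pow)
next
  case (insert i I)
  define U' where "U' = U - B i"
  have disj: "B j \<inter> B i = {}" if "j \<in> I" for j
    using insert.prems(3) insert.hyps(2) that unfolding disjoint_family_on_def by auto
  have fin: "finite (B i)" "finite U'" and U: "U = B i \<union> U'"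
    using insert.prems(1,2) finite_subset[of "B i" U] unfolding U'_def by auto
  have IH: "(\<Sum>E\<in>Pow U'. \<Prod>j\<in>I. w j (E \<inter> B j)) =
      2 ^ card U' * (\<Prod>j\<in>I. (\<Sum>D\<in>Pow (B j). w j D) / 2 ^ card (B j))"
    using insert.prems disj fin unfolding U'_def
    by (intro insert.IH) (auto simp: disjoint_family_on_def)
  have "(\<Sum>E\<in>Pow U. \<Prod>j\<in>insert i I. w j (E \<inter> B j)) =
      (\<Sum>D\<in>Pow (B i). \<Sum>E\<in>Pow U'. \<Prod>j\<in>insert i I. w j ((D \<union> E) \<inter> B j))"
    unfolding U by (rule sum_Pow_disjoint_Un) (use fin in \<open>auto simp: U'_def\<close>)
  also have "\<dots> = (\<Sum>D\<in>Pow (B i). \<Sum>E\<in>Pow U'. w i D * (\<Prod>j\<in>I. w j (E \<inter> B j)))"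
  proof (intro sum.cong refl)
    fix D E assume DE: "D \<in> Pow (B i)" "E \<in> Pow U'"
    have "(D \<union> E) \<inter> B i = D" "\<And>j. j \<in> I \<Longrightarrow> (D \<union> E) \<inter> B j = E \<inter> B j"
      using DE disj unfolding U'_def by blast+
    then show "(\<Prod>j\<in>insert i I. w j ((D \<union> E) \<inter> B j)) = w i D * (\<Prod>j\<in>I. w j (E \<inter> B j))"
      using insert.hyps by simp
  qed
  also have "\<dots> = (\<Sum>D\<in>Pow (B i). w i D) * (\<Sum>E\<in>Pow U'. \<Prod>j\<in>I. w j (E \<inter> B j))"
    by (simp add: sum_product)
  also have "card U = card (B i) + card U'"
    unfolding U using fin by (intro card_Un_disjoint) (auto simp: U'_def)
  ultimately show ?case
    using insert.hyps IH by (simp add: power_add)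
qed

text \<open>Markov's inequality for \<open>z ^ X\<close>, where \<open>X\<close> counts the blocks whose trace satisfies \<open>Q\<close> and
  \<open>q\<close> is the probability of \<open>Q\<close>; a bound on \<open>q\<close> from above is needed for \<open>z \<ge> 1\<close> and from below
  for \<open>z \<le> 1\<close>.\<close>

lemma card_Pow_tail_le:
  fixes z q K :: real
  assumes U: "finite U" and I: "finite I" and B: "\<And>i. i \<in> I \<Longrightarrow> B i \<subseteq> U" "disjoint_family_on B I"
    and z: "0 \<le> z" and K: "0 \<le> K"
    and q: "\<And>i. i \<in> I \<Longrightarrow> (z - 1) * real (card {D \<in> Pow (B i). Q i D}) \<le> (z - 1) * q * 2 ^ card (B i)"
    and \<Phi>: "\<And>E. E \<subseteq> U \<Longrightarrow> \<Phi> E \<Longrightarrow> 1 \<le> K * z ^ card {i \<in> I. Q i (E \<inter> B i)}"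
  shows "real (card {E \<in> Pow U. \<Phi> E}) \<le> K * (1 + (z - 1) * q) ^ card I * 2 ^ card U"
proof -
  define w where "w i D = (if Q i D then z else 1)" for i D
  have prod: "(\<Prod>i\<in>I. w i (E \<inter> B i)) = z ^ card {i \<in> I. Q i (E \<inter> B i)}" for E
    unfolding w_def using I by (simp add: prod.If_cases Int_def)
  have mean: "(\<Sum>D\<in>Pow (B i). w i D) / 2 ^ card (B i) \<le> 1 + (z - 1) * q" if i: "i \<in> I" for i
  proof -
    have fin: "finite (B i)"
      using B(1)[OF i] U finite_subset by blast
    have "w i D = 1 + (z - 1) * of_bool (Q i D)" for D
      by (simp add: w_def)
    then have "(\<Sum>D\<in>Pow (B i). w i D) = 2 ^ card (B i) + (z - 1) * real (card {D \<in> Pow (B i). Q i D})"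
      using fin by (simp add: sum.distrib card_Pow sum_distrib_left[symmetric] sum_of_bool_eq Int_def)
    also have "\<dots> \<le> (1 + (z - 1) * q) * 2 ^ card (B i)"
      using q[OF i] by (simp add: algebra_simps)
    finally show ?thesis
      by (simp add: divide_le_eq)
  qed
  have "real (card {E \<in> Pow U. \<Phi> E}) = (\<Sum>E\<in>{E \<in> Pow U. \<Phi> E}. 1)"
    by simp
  also have "\<dots> \<le> (\<Sum>E\<in>{E \<in> Pow U. \<Phi> E}. K * (\<Prod>i\<in>I. w i (E \<inter> B i)))"
    unfolding prod by (intro sum_mono) (use \<Phi> in auto)
  also have "\<dots> \<le> (\<Sum>E\<in>Pow U. K * (\<Prod>i\<in>I. w i (E \<inter> B i)))"
    using U z K by (intro sum_mono2) (auto simp: prod)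
  also have "\<dots> = K * (2 ^ card U * (\<Prod>i\<in>I. (\<Sum>D\<in>Pow (B i). w i D) / 2 ^ card (B i)))"
    using sum_Pow_prod_blocks[OF U I B, of w] by (simp add: sum_distrib_left[symmetric])
  also have "\<dots> \<le> K * (2 ^ card U * (\<Prod>i\<in>I. 1 + (z - 1) * q))"
    using K z mean by (intro mult_left_mono prod_mono) (auto simp: w_def intro!: sum_nonneg divide_nonneg_nonneg)
  finally show ?thesis
    by (simp add: mult_ac)
qed

section \<open>Exceptional events for random edge sets\<close>

definition all_edges :: "nat \<Rightarrow> nat set set" where
  "all_edges n = {e. e \<subseteq> {1..n} \<and> card e = 2}"

definition nbhd :: "nat \<Rightarrow> nat set set \<Rightarrow> nat \<Rightarrow> nat set" where
  "nbhd n E v = {x \<in> {1..n}. {x, v} \<in> E}"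

definition cross :: "'a set \<Rightarrow> 'a set \<Rightarrow> 'a set set" where
  "cross A B = (\<lambda>(a, b). {a, b}) ` (A \<times> B)"

definition index_pairs :: "nat \<Rightarrow> (nat \<times> nat) set" where
  "index_pairs p = {(i, j). i < j \<and> j < p}"

text \<open>The event is that the listed vertices have no common neighbour at all. A list instead of
  a set allows repetitions, so lists of length five cover all smaller nonempty sets as well.\<close>

definition few_common_nbrs :: "nat \<Rightarrow> nat set set \<Rightarrow> nat list \<Rightarrow> bool" where
  "few_common_nbrs n E xs \<longleftrightarrow> (\<forall>x\<in>{1..n}. \<exists>a\<in>set xs. {x, a} \<notin> E)"

text \<open>The tuple \<open>w\<close> encodes the \<open>p\<close> disjoint pairs \<open>{w i, w (p + i)}\<close>. In a random graph two such
  pairs are unjoined with probability 1/16, and two vertices with probability 1/2; the threshold 1/4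
  separates these.\<close>

definition sparse_between :: "nat \<Rightarrow> nat set set \<Rightarrow> (nat \<Rightarrow> nat) \<Rightarrow> bool" where
  "sparse_between p E w \<longleftrightarrow> inj_on w {..<2 * p} \<and>
    p choose 2 \<le> 4 * card {(i, j) \<in> index_pairs p. E \<inter> cross {w i, w (p + i)} {w j, w (p + j)} = {}}"

definition dense_on :: "nat \<Rightarrow> nat set set \<Rightarrow> (nat \<Rightarrow> nat) \<Rightarrow> bool" where
  "dense_on p E w \<longleftrightarrow> inj_on w {..<p} \<and>
    4 * card {(i, j) \<in> index_pairs p. {w i, w j} \<notin> E} \<le> p choose 2"

text \<open>The second half of \<open>w\<close> is meant to be the image of the first half under a
  nontrivial automorphism.\<close>

definition copied_subgraph :: "nat \<Rightarrow> nat set set \<Rightarrow> (nat \<Rightarrow> nat) \<Rightarrow> bool" where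
  "copied_subgraph p E w \<longleftrightarrow> inj_on w {..<2 * p} \<and>
    (\<forall>(i, j)\<in>index_pairs p. {w i, w j} \<in> E \<longleftrightarrow> {w (p + i), w (p + j)} \<in> E)"

lemma finite_all_edges: "finite (all_edges n)"
  unfolding all_edges_def by simp

lemma card_all_edges: "card (all_edges n) = n choose 2"
  unfolding all_edges_def by (simp add: n_subsets)

lemma doubleton_in_all_edges: "{a, b} \<in> all_edges n \<longleftrightarrow> a \<in> {1..n} \<and> b \<in> {1..n} \<and> a \<noteq> b"
  unfolding all_edges_def by auto

lemma finite_index_pairs: "finite (index_pairs p)"
  by (rule finite_subset[of _ "{..<p} \<times> {..<p}"]) (auto simp: index_pairs_def)

lemma card_index_pairs: "card (index_pairs p) = p choose 2"
proof -
  have "index_pairs p = (SIGMA j:{..<p}. {..<j})\<inverse>"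
    unfolding index_pairs_def by auto
  then have "card (index_pairs p) = (\<Sum>j<p. j)"
    by (simp add: card_inverse)
  then show ?thesis
    by (simp add: gauss_sum_nat lessThan_atLeast0 choose_two Sum_Ico_nat)
qed

section \<open>Disjoint blocks of possible edges\<close>

lemma disjoint_family_stars: "disjoint_family_on (\<lambda>x. (\<lambda>a. {x, a}) ` S) (V - S)"
  unfolding disjoint_family_on_def by (auto simp: doubleton_eq_iff)

lemma card_star: "x \<notin> S \<Longrightarrow> card ((\<lambda>a. {x, a}) ` S) = card S"
  by (rule card_image) (auto simp: inj_on_def doubleton_eq_iff)

lemma star_subset_all_edges:
  assumes "x \<in> {1..n} - S" "S \<subseteq> {1..n}"
  shows "(\<lambda>a. {x, a}) ` S \<subseteq> all_edges n"
  using assms doubleton_in_all_edges by blast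

text \<open>An edge determines the unordered pair of sets that it joins. A crosswise match
  \<open>i = l\<close>, \<open>j = k\<close> is excluded by the order \<open>i < j\<close>,
  \<open>k < l\<close> built into \<open>index_pairs\<close>.\<close>

lemma disjoint_family_cross:
  assumes "disjoint_family_on P {..<p}"
  shows "disjoint_family_on (\<lambda>(i, j). cross (P i) (P j)) (index_pairs p)"
proof -
  have eq: "i = k" if "a \<in> P i" "a \<in> P k" "i < p" "k < p" for a i k
    using assms that unfolding disjoint_family_on_def by blast
  have "(i, j) = (k, l)" if ij: "i < j" "j < p" and kl: "k < l" "l < p"
    and e: "e \<in> cross (P i) (P j)" "e \<in> cross (P k) (P l)" for i j k l e
  proof -
    obtain a b c d where ab: "a \<in> P i" "b \<in> P j" "c \<in> P k" "d \<in> P l" "{a, b} = {c, d}"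
      using e unfolding cross_def by auto
    from ab(5) consider "a = c" "b = d" | "a = d" "b = c"
      unfolding doubleton_eq_iff by blast
    then show ?thesis
    proof cases
      case 1
      then show ?thesis
        using eq[of a i k] eq[of b j l] ab ij kl by simp
    next
      case 2
      then have "i = l" "j = k"
        using eq[of a i l] eq[of b j k] ab ij kl by simp_all
      then show ?thesis
        using ij kl by simp
    qed
  qed
  then show ?thesis
    unfolding disjoint_family_on_def index_pairs_def by blast
qed

lemma card_cross:
  assumes "A \<inter> B = {}"
  shows "card (cross A B) = card A * card B"
  unfolding cross_def card_cartesian_product[symmetric]
  by (rule card_image) (use assms in \<open>auto simp: inj_on_def doubleton_eq_iff\<close>)

lemma cross_subset_all_edges:
  assumes "A \<subseteq> {1..n}" "B \<subseteq> {1..n}" "A \<inter> B = {}"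
  shows "cross A B \<subseteq> all_edges n"
proof -
  have "{a, b} \<in> all_edges n" if "a \<in> A" "b \<in> B" for a b
    using assms that unfolding doubleton_in_all_edges by blast
  then show ?thesis
    unfolding cross_def by auto
qed

lemma cross_family_subset_all_edges:
  assumes "disjoint_family_on P {..<p}" "\<And>i. i < p \<Longrightarrow> P i \<subseteq> {1..n}" "x \<in> index_pairs p"
  shows "(\<lambda>(i, j). cross (P i) (P j)) x \<subseteq> all_edges n"
proof -
  obtain i j where x: "x = (i, j)" "i < p" "j < p" "i \<noteq> j"
    using assms(3) unfolding index_pairs_def by auto
  have "cross (P i) (P j) \<subseteq> all_edges n"
    using assms(1,2) x(2-4) by (intro cross_subset_all_edges) (auto simp: disjoint_family_on_def)
  then show ?thesis
    by (simp add: x(1))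
qed

section \<open>Probabilities of the single exceptional events\<close>

lemma sqrt_2_power_4_mult: "sqrt 2 ^ (4 * k) = 4 ^ k"
proof -
  have "sqrt 2 ^ (4 * k) = ((sqrt 2 ^ 2) ^ 2) ^ k"
    unfolding power_mult[symmetric] by simp
  then show ?thesis
    by simp
qed

text \<open>Each of the at least \<open>n - 5\<close> vertices outside the list is joined to all
  listed vertices with probability at least 1/32, independently of the others. The tail bound with
  \<open>z = 0\<close> is the probability that this never happens.\<close>

lemma card_few_common_nbrs_le:
  assumes "set xs \<subseteq> {1..n}" "length xs = 5"
  shows "real (card {E \<in> Pow (all_edges n). few_common_nbrs n E xs}) \<le>
    (31 / 32) ^ (n - 5) * 2 ^ card (all_edges n)"
proof -
  let ?S = "set xs"
  define B where "B x = (\<lambda>a. {x, a}) ` ?S" for x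
  have S: "card ?S \<le> 5"
    using assms(2) card_length by metis
  have cB: "card (B x) \<le> 5" if "x \<in> {1..n} - ?S" for x
    using that S unfolding B_def by (simp add: card_star)
  have "real (card {E \<in> Pow (all_edges n). few_common_nbrs n E xs}) \<le>
      1 * (1 + (0 - 1) * (1 / 32)) ^ card ({1..n} - ?S) * 2 ^ card (all_edges n)"
  proof (rule card_Pow_tail_le[where B = B and Q = "\<lambda>x D. D = B x"])
    show "disjoint_family_on B ({1..n} - ?S)"
      unfolding B_def by (rule disjoint_family_stars)
    show "B x \<subseteq> all_edges n" if "x \<in> {1..n} - ?S" for x
      unfolding B_def using star_subset_all_edges[OF that assms(1)] .
    show "(0 - 1) * real (card {D \<in> Pow (B x). D = B x}) \<le> (0 - 1) * (1 / 32) * 2 ^ card (B x)"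
      if "x \<in> {1..n} - ?S" for x
    proof -
      have "{D \<in> Pow (B x). D = B x} = {B x}"
        by auto
      moreover have "(2::real) ^ card (B x) \<le> 2 ^ 5"
        using cB[OF that] by (intro power_increasing) auto
      ultimately show ?thesis
        by simp
    qed
    \<comment> \<open>With \<open>z = 0\<close> only the edge sets in which every block fails keep a
      nonzero weight, namely \<open>0 ^ 0 = 1\<close>.\<close>
    show "1 \<le> 1 * (0::real) ^ card {x \<in> {1..n} - ?S. E \<inter> B x = B x}"
      if "few_common_nbrs n E xs" for E
    proof -
      have none: "{x \<in> {1..n} - ?S. E \<inter> B x = B x} = {}"
        using that unfolding few_common_nbrs_def B_def by blast
      show ?thesis
        unfolding none by simp
    qed
  qed (simp_all add: finite_all_edges)
  also have "\<dots> = (31 / 32) ^ card ({1..n} - ?S) * 2 ^ card (all_edges n)"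
    by simp
  also have "\<dots> \<le> (31 / 32) ^ (n - 5) * 2 ^ card (all_edges n)"
    using S assms(1) by (intro mult_right_mono power_decreasing) (simp_all add: card_Diff_subset)
  finally show ?thesis .
qed

lemma card_large_degree_le:
  assumes "s \<in> {1..n}"
  shows "real (card {E \<in> Pow (all_edges n). 3 * n \<le> 5 * card (nbhd n E s)}) \<le>
    (99 / 100) ^ n * 2 ^ card (all_edges n)"
proof -
  \<comment> \<open>The fifth power turns the threshold \<open>3 n / 5\<close> into integer
    exponents. The base 11/10 makes \<open>(10 / 11) ^ 3 * (1 + z) / 2\<close> less than
    99/100.\<close>
  define z :: real where "z = (11 / 10) ^ 5"
  define B where "B x = (\<lambda>a. {x, a}) ` {s}" for x
  have "real (card {E \<in> Pow (all_edges n). 3 * n \<le> 5 * card (nbhd n E s)}) \<le>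
      (10 / 11) ^ (3 * n) * (1 + (z - 1) * (1 / 2)) ^ card ({1..n} - {s}) * 2 ^ card (all_edges n)"
  proof (rule card_Pow_tail_le[where B = B and Q = "\<lambda>x D. D \<noteq> {}"])
    show "disjoint_family_on B ({1..n} - {s})"
      unfolding B_def by (rule disjoint_family_stars)
    show "B x \<subseteq> all_edges n" if "x \<in> {1..n} - {s}" for x
      unfolding B_def using star_subset_all_edges[OF that] assms by simp
    show "(z - 1) * real (card {D \<in> Pow (B x). D \<noteq> {}}) \<le> (z - 1) * (1 / 2) * 2 ^ card (B x)" for x
    proof -
      have "{D \<in> Pow (B x). D \<noteq> {}} = {{{x, s}}}"
        unfolding B_def by auto
      then show ?thesis
        by (simp add: B_def)
    qed
    show "1 \<le> (10 / 11) ^ (3 * n) * z ^ card {x \<in> {1..n} - {s}. E \<inter> B x \<noteq> {}}"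
      if E: "E \<subseteq> all_edges n" and deg: "3 * n \<le> 5 * card (nbhd n E s)" for E
    proof -
      have "{x \<in> {1..n} - {s}. E \<inter> B x \<noteq> {}} = nbhd n E s"
        using E doubleton_in_all_edges[of s s n] unfolding B_def nbhd_def by auto
      then have "z ^ card {x \<in> {1..n} - {s}. E \<inter> B x \<noteq> {}} = (11 / 10) ^ (5 * card (nbhd n E s))"
        by (simp add: z_def power_mult)
      also have "\<dots> \<ge> (11 / 10) ^ (3 * n)"
        using deg by (intro power_increasing) auto
      finally have "(10 / 11) ^ (3 * n) * (11 / 10) ^ (3 * n) \<le>
          (10 / 11) ^ (3 * n) * z ^ card {x \<in> {1..n} - {s}. E \<inter> B x \<noteq> {}}"
        by (intro mult_left_mono) auto
      then show ?thesis
        by (simp add: power_mult_distrib[symmetric])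
    qed
  qed (simp_all add: finite_all_edges z_def)
  \<comment> \<open>The factor per vertex exceeds 1, so counting \<open>s\<close> as well only
    enlarges the bound.\<close>
  also have "\<dots> \<le> (10 / 11) ^ (3 * n) * (1 + (z - 1) * (1 / 2)) ^ n * 2 ^ card (all_edges n)"
    using card_mono[of "{1..n}" "{1..n} - {s}"]
    by (intro mult_right_mono mult_left_mono power_increasing) (simp_all add: z_def)
  also have "\<dots> = ((10 / 11) ^ 3 * (1 + (z - 1) * (1 / 2))) ^ n * 2 ^ card (all_edges n)"
    by (simp add: power_mult power_mult_distrib)
  also have "\<dots> \<le> (99 / 100) ^ n * 2 ^ card (all_edges n)"
    by (intro mult_right_mono power_mono) (simp_all add: z_def power_divide)
  finally show ?thesis .
qed

lemma card_small_nbhd_Un_le: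
  assumes uv: "u \<in> {1..n}" "v \<in> {1..n}" "u \<noteq> v"
  shows "real (card {E \<in> Pow (all_edges n). 20 * card (nbhd n E u \<union> nbhd n E v) \<le> 13 * n}) \<le>
    3 * (99 / 100) ^ n * 2 ^ card (all_edges n)"
proof -
  \<comment> \<open>A vertex is joined to \<open>u\<close> or \<open>v\<close> with probability 3/4,
    above the threshold 13/20, so the lower tail calls for \<open>z < 1\<close>. The power 20 clears
    the denominator, and the base makes \<open>(30 / 29) ^ 13 * ?c\<close> less than 99/100.\<close>
  define z :: real where "z = (29 / 30) ^ 20"
  define B where "B x = (\<lambda>a. {x, a}) ` {u, v}" for x
  let ?c = "1 + (z - 1) * (3 / 4)"
  have "real (card {E \<in> Pow (all_edges n). 20 * card (nbhd n E u \<union> nbhd n E v) \<le> 13 * n}) \<le>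
      (30 / 29) ^ (13 * n) * ?c ^ card ({1..n} - {u, v}) * 2 ^ card (all_edges n)"
  proof (rule card_Pow_tail_le[where B = B and Q = "\<lambda>x D. D \<noteq> {}"])
    show "disjoint_family_on B ({1..n} - {u, v})"
      unfolding B_def by (rule disjoint_family_stars)
    show "B x \<subseteq> all_edges n" if "x \<in> {1..n} - {u, v}" for x
      unfolding B_def using star_subset_all_edges[OF that] uv by simp
    show "(z - 1) * real (card {D \<in> Pow (B x). D \<noteq> {}}) \<le> (z - 1) * (3 / 4) * 2 ^ card (B x)"
      if "x \<in> {1..n} - {u, v}" for x
    proof -
      have "card (B x) = 2"
        using that uv card_star[of x "{u, v}"] unfolding B_def by simp
      moreover have "{D \<in> Pow (B x). D \<noteq> {}} = Pow (B x) - {{}}"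
        by auto
      moreover have "finite (B x)"
        by (simp add: B_def)
      ultimately show ?thesis
        by (simp add: card_Pow)
    qed
    show "1 \<le> (30 / 29) ^ (13 * n) * z ^ card {x \<in> {1..n} - {u, v}. E \<inter> B x \<noteq> {}}"
      if deg: "20 * card (nbhd n E u \<union> nbhd n E v) \<le> 13 * n" for E
    proof -
      let ?X = "{x \<in> {1..n} - {u, v}. E \<inter> B x \<noteq> {}}"
      have "card ?X \<le> card (nbhd n E u \<union> nbhd n E v)"
        by (rule card_mono) (auto simp: B_def nbhd_def)
      then have "(29 / 30) ^ (13 * n) \<le> (29 / 30 :: real) ^ (20 * card ?X)"
        using deg by (intro power_decreasing) auto
      also have "\<dots> = z ^ card ?X"
        by (simp add: z_def power_mult)
      finally have "(30 / 29) ^ (13 * n) * (29 / 30) ^ (13 * n) \<le> (30 / 29) ^ (13 * n) * z ^ card ?X"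
        by (intro mult_left_mono) auto
      then show ?thesis
        by (simp add: power_mult_distrib[symmetric])
    qed
  qed (simp_all add: finite_all_edges z_def)
  \<comment> \<open>Here \<open>?c < 1\<close>. The blocks omit the two vertices \<open>u\<close>
    and \<open>v\<close>; raising the exponent to \<open>n\<close> costs the inverse square of
    \<open>?c\<close>, which is at most 3.\<close>
  also have "\<dots> \<le> (30 / 29) ^ (13 * n) * (3 * ?c ^ n) * 2 ^ card (all_edges n)"
  proof -
    have "card ({1..n} - {u, v}) = n - 2" "2 \<le> n"
      using uv card_mono[of "{1..n}" "{u, v}"] by (simp_all add: card_Diff_subset)
    then have "c ^ n = c ^ 2 * c ^ card ({1..n} - {u, v})" for c :: real
      by (metis le_add_diff_inverse power_add)
    moreover have "1 / 3 \<le> ?c ^ 2" "0 \<le> ?c"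
      by (simp_all add: z_def power_divide power2_eq_square)
    ultimately have "?c ^ card ({1..n} - {u, v}) \<le> 3 * ?c ^ n"
      using mult_right_mono[of "1/3" "?c ^ 2" "?c ^ card ({1..n} - {u, v})"] by simp
    then show ?thesis
      by (intro mult_right_mono mult_left_mono) auto
  qed
  also have "\<dots> = 3 * ((30 / 29) ^ 13 * ?c) ^ n * 2 ^ card (all_edges n)"
    by (simp add: power_mult power_mult_distrib)
  also have "\<dots> \<le> 3 * (99 / 100) ^ n * 2 ^ card (all_edges n)"
    by (intro mult_right_mono mult_left_mono power_mono) (simp_all add: z_def power_divide)
  finally show ?thesis .
qed

text \<open>Every vertex other than \<open>u\<close>, \<open>v\<close> is in the difference with
  probability 1/4. With \<open>z = 1 / 2\<close> the tail bound yields
  \<open>1 - 1 / 8 = 7 / 8\<close> per vertex, and the threshold \<open>3 * p\<close> costs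
  \<open>2 ^ (3 * p) = 8 ^ p\<close>.\<close>

lemma card_small_nbhd_diff_le:
  assumes uv: "u \<in> {1..n}" "v \<in> {1..n}" "u \<noteq> v"
  shows "real (card {E \<in> Pow (all_edges n). card (nbhd n E u - nbhd n E v) < 3 * p}) \<le>
    8 ^ p * (7 / 8) ^ (n - 2) * 2 ^ card (all_edges n)"
proof -
  define B where "B x = (\<lambda>a. {x, a}) ` {u, v}" for x
  have "real (card {E \<in> Pow (all_edges n). card (nbhd n E u - nbhd n E v) < 3 * p}) \<le>
      8 ^ p * (1 + (1 / 2 - 1) * (1 / 4)) ^ card ({1..n} - {u, v}) * 2 ^ card (all_edges n)"
  proof (rule card_Pow_tail_le[where B = B and Q = "\<lambda>x D. {x, u} \<in> D \<and> {x, v} \<notin> D"])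
    show "disjoint_family_on B ({1..n} - {u, v})"
      unfolding B_def by (rule disjoint_family_stars)
    show "B x \<subseteq> all_edges n" if "x \<in> {1..n} - {u, v}" for x
      unfolding B_def using star_subset_all_edges[OF that] uv by simp
    show "(1 / 2 - 1) * real (card {D \<in> Pow (B x). {x, u} \<in> D \<and> {x, v} \<notin> D})
        \<le> (1 / 2 - 1) * (1 / 4) * 2 ^ card (B x)" if "x \<in> {1..n} - {u, v}" for x
    proof -
      have "card (B x) = 2"
        using that uv card_star[of x "{u, v}"] unfolding B_def by simp
      moreover have "{D \<in> Pow (B x). {x, u} \<in> D \<and> {x, v} \<notin> D} = {{{x, u}}}"
        using that uv unfolding B_def by (auto simp: doubleton_eq_iff)
      ultimately show ?thesis
        by simp
    qed
    show "1 \<le> 8 ^ p * (1 / 2 :: real) ^ card {x \<in> {1..n} - {u, v}. {x, u} \<in> E \<inter> B x \<and> {x, v} \<notin> E \<inter> B x}"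
      if deg: "card (nbhd n E u - nbhd n E v) < 3 * p" for E
    proof -
      let ?X = "{x \<in> {1..n} - {u, v}. {x, u} \<in> E \<inter> B x \<and> {x, v} \<notin> E \<inter> B x}"
      have "card ?X \<le> card (nbhd n E u - nbhd n E v)"
        by (rule card_mono) (auto simp: B_def nbhd_def)
      then have "(1 / 2 :: real) ^ (3 * p) \<le> (1 / 2) ^ card ?X"
        using deg by (intro power_decreasing) auto
      then have "8 ^ p * (1 / 2) ^ (3 * p) \<le> 8 ^ p * (1 / 2 :: real) ^ card ?X"
        by (intro mult_left_mono) auto
      then show ?thesis
        by (simp add: power_mult power_mult_distrib[symmetric] power_divide)
    qed
  qed (simp_all add: finite_all_edges)
  also have "card ({1..n} - {u, v}) = n - 2"
    using uv by (simp add: card_Diff_subset)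
  finally show ?thesis
    by simp
qed

lemma inj_on_pairs:
  fixes p :: nat
  assumes "inj_on w {..<2 * p}" "i < p" "j < p" "i \<noteq> j"
  shows "w i \<noteq> w j" "w i \<noteq> w (p + j)" "w (p + i) \<noteq> w j" "w (p + i) \<noteq> w (p + j)" "w i \<noteq> w (p + i)"
  using assms by (simp_all add: inj_on_eq_iff)

text \<open>The four possible edges between two pairs are all missing with probability 1/16. With
  \<open>z = 4\<close> each pair of pairs contributes \<open>1 + 3 / 16 = 19 / 16\<close>, and the
  threshold of one quarter divides this by the fourth root of 4, which is \<open>sqrt 2\<close>. The
  quotient is below 9/10.\<close>

lemma card_sparse_between_le:
  assumes w: "w ` {..<2 * p} \<subseteq> {1..n}"
  shows "real (card {E \<in> Pow (all_edges n). sparse_between p E w}) \<le>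
    (9 / 10) ^ (p choose 2) * 2 ^ card (all_edges n)"
proof (cases "inj_on w {..<2 * p}")
  case inj: True
  define P where "P i = {w i, w (p + i)}" for i
  define B where "B = (\<lambda>(i, j). cross (P i) (P j))"
  have V: "P i \<subseteq> {1..n}" if "i < p" for i
    using w that unfolding P_def by (auto simp: image_subset_iff)
  have disj: "P i \<inter> P j = {}" if "i < p" "j < p" "i \<noteq> j" for i j
    using inj_on_pairs[OF inj that] unfolding P_def by auto
  have cB: "card (B (i, j)) = 4" if "(i, j) \<in> index_pairs p" for i j
    using that disj[of i j] inj_on_pairs(5)[OF inj, of i j] inj_on_pairs(5)[OF inj, of j i]
    by (simp add: B_def card_cross index_pairs_def) (simp add: P_def)
  have "real (card {E \<in> Pow (all_edges n). sparse_between p E w}) \<le>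
      (1 / sqrt 2) ^ (p choose 2) * (1 + (4 - 1) * (1 / 16)) ^ card (index_pairs p) * 2 ^ card (all_edges n)"
  proof (rule card_Pow_tail_le[where B = B and Q = "\<lambda>x D. D = {}"])
    show "disjoint_family_on B (index_pairs p)"
      unfolding B_def using disj
      by (intro disjoint_family_cross) (auto simp: disjoint_family_on_def)
    show "B x \<subseteq> all_edges n" if "x \<in> index_pairs p" for x
      unfolding B_def using disj V that
      by (intro cross_family_subset_all_edges) (auto simp: disjoint_family_on_def)
    show "(4 - 1) * real (card {D \<in> Pow (B x). D = {}}) \<le> (4 - 1) * (1 / 16) * 2 ^ card (B x)"
      if "x \<in> index_pairs p" for x
    proof -
      have "{D \<in> Pow (B x). D = {}} = {{}}"
        by auto
      then show ?thesis
        using cB[of "fst x" "snd x"] that by simp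
    qed
    show "1 \<le> (1 / sqrt 2) ^ (p choose 2) * 4 ^ card {x \<in> index_pairs p. E \<inter> B x = {}}"
      if sp: "sparse_between p E w" for E
    proof -
      have "{(i, j) \<in> index_pairs p. E \<inter> cross {w i, w (p + i)} {w j, w (p + j)} = {}} =
          {x \<in> index_pairs p. E \<inter> B x = {}}"
        unfolding B_def P_def by auto
      then have "sqrt 2 ^ (p choose 2) \<le> sqrt 2 ^ (4 * card {x \<in> index_pairs p. E \<inter> B x = {}})"
        using sp unfolding sparse_between_def by (intro power_increasing) auto
      also have "\<dots> = 4 ^ card {x \<in> index_pairs p. E \<inter> B x = {}}"
        by (rule sqrt_2_power_4_mult)
      finally show ?thesis
        by (simp add: power_divide le_divide_eq)
    qed
  qed (simp_all add: finite_all_edges finite_index_pairs)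
  also have "\<dots> = ((19 / 16) / sqrt 2) ^ (p choose 2) * 2 ^ card (all_edges n)"
    by (simp add: card_index_pairs power_divide)
  also have "\<dots> \<le> (9 / 10) ^ (p choose 2) * 2 ^ card (all_edges n)"
  proof -
    have "4 / 3 \<le> sqrt 2"
      by (rule real_le_rsqrt) (simp add: power2_eq_square)
    then show ?thesis
      by (intro mult_right_mono power_mono) (simp_all add: divide_le_eq)
  qed
  finally show ?thesis .
qed (simp add: sparse_between_def)

text \<open>This is the opposite tail, with \<open>z = 1 / 4\<close>: an edge is missing with
  probability 1/2, which gives \<open>1 - 3 / 8 = 5 / 8\<close>, and the threshold of one quarter
  multiplies this by \<open>sqrt 2\<close>. The product is below 9/10.\<close>

lemma card_dense_on_le:
  assumes w: "w ` {..<p} \<subseteq> {1..n}"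
  shows "real (card {E \<in> Pow (all_edges n). dense_on p E w}) \<le>
    (9 / 10) ^ (p choose 2) * 2 ^ card (all_edges n)"
proof (cases "inj_on w {..<p}")
  case inj: True
  define B where "B = (\<lambda>(i, j). cross {w i} {w j})"
  have V: "{w i} \<subseteq> {1..n}" if "i < p" for i
    using w that by (auto simp: image_subset_iff)
  have disj: "{w i} \<inter> {w j} = {}" if "i < p" "j < p" "i \<noteq> j" for i j
    using inj that by (simp add: inj_on_eq_iff)
  have cB: "card (B (i, j)) = 1" for i j
    by (simp add: B_def cross_def)
  have "real (card {E \<in> Pow (all_edges n). dense_on p E w}) \<le>
      sqrt 2 ^ (p choose 2) * (1 + (1 / 4 - 1) * (1 / 2)) ^ card (index_pairs p) * 2 ^ card (all_edges n)"
  proof (rule card_Pow_tail_le[where B = B and Q = "\<lambda>x D. D = {}"])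
    show "disjoint_family_on B (index_pairs p)"
      unfolding B_def using disj
      by (intro disjoint_family_cross) (auto simp: disjoint_family_on_def)
    show "B x \<subseteq> all_edges n" if "x \<in> index_pairs p" for x
      unfolding B_def using disj V that
      by (intro cross_family_subset_all_edges) (auto simp: disjoint_family_on_def)
    show "(1 / 4 - 1) * real (card {D \<in> Pow (B x). D = {}}) \<le> (1 / 4 - 1) * (1 / 2) * 2 ^ card (B x)" for x
    proof -
      have "{D \<in> Pow (B x). D = {}} = {{}}"
        by auto
      then show ?thesis
        using cB[of "fst x" "snd x"] by simp
    qed
    show "1 \<le> sqrt 2 ^ (p choose 2) * (1 / 4) ^ card {x \<in> index_pairs p. E \<inter> B x = {}}"
      if dn: "dense_on p E w" for E
    proof -
      have "{(i, j) \<in> index_pairs p. {w i, w j} \<notin> E} = {x \<in> index_pairs p. E \<inter> B x = {}}"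
        unfolding B_def cross_def by auto
      then have "sqrt 2 ^ (4 * card {x \<in> index_pairs p. E \<inter> B x = {}}) \<le> sqrt 2 ^ (p choose 2)"
        using dn unfolding dense_on_def by (intro power_increasing) auto
      moreover have "sqrt 2 ^ (4 * card {x \<in> index_pairs p. E \<inter> B x = {}}) =
          4 ^ card {x \<in> index_pairs p. E \<inter> B x = {}}"
        by (rule sqrt_2_power_4_mult)
      ultimately show ?thesis
        by (simp add: power_divide le_divide_eq)
    qed
  qed (simp_all add: finite_all_edges finite_index_pairs)
  also have "\<dots> = (sqrt 2 * (5 / 8)) ^ (p choose 2) * 2 ^ card (all_edges n)"
    by (subst power_mult_distrib) (simp add: card_index_pairs)
  also have "\<dots> \<le> (9 / 10) ^ (p choose 2) * 2 ^ card (all_edges n)"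
  proof -
    have "sqrt 2 \<le> 36 / 25"
      by (rule real_le_lsqrt) (simp_all add: power2_eq_square)
    then show ?thesis
      by (intro mult_right_mono power_mono) simp_all
  qed
  finally show ?thesis .
qed (simp add: dense_on_def)

text \<open>For every pair of indices, the two distinct edges that have to agree do so with
  probability 1/2. These two-element blocks lie in the crosses of the disjoint sets
  \<open>P i\<close>, hence are disjoint, and the tail bound applies with
  \<open>z = 0\<close>.\<close>

lemma card_copied_subgraph_le:
  assumes w: "w ` {..<2 * p} \<subseteq> {1..n}"
  shows "real (card {E \<in> Pow (all_edges n). copied_subgraph p E w}) \<le>
    (9 / 10) ^ (p choose 2) * 2 ^ card (all_edges n)"
proof (cases "inj_on w {..<2 * p}")
  case inj: True
  define P where "P i = {w i, w (p + i)}" for i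
  define d e where "d = (\<lambda>(i, j). {w i, w j})" and "e = (\<lambda>(i, j). {w (p + i), w (p + j)})"
  define B where "B x = {d x, e x}" for x
  have V: "P i \<subseteq> {1..n}" if "i < p" for i
    using w that unfolding P_def by (auto simp: image_subset_iff)
  have disj: "P i \<inter> P j = {}" if "i < p" "j < p" "i \<noteq> j" for i j
    using inj_on_pairs[OF inj that] unfolding P_def by auto
  have sub: "B x \<subseteq> (\<lambda>(i, j). cross (P i) (P j)) x" for x
    unfolding B_def d_def e_def P_def cross_def by (auto split: prod.splits)
  have ne: "d x \<noteq> e x" if "x \<in> index_pairs p" for x
    using that inj_on_pairs[OF inj, of "fst x" "snd x"] inj_on_pairs(5)[OF inj, of "snd x" "fst x"]
    unfolding d_def e_def index_pairs_def by (auto simp: doubleton_eq_iff)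
  have "real (card {E \<in> Pow (all_edges n). copied_subgraph p E w}) \<le>
      1 * (1 + (0 - 1) * (1 / 2)) ^ card (index_pairs p) * 2 ^ card (all_edges n)"
  proof (rule card_Pow_tail_le[where B = B and Q = "\<lambda>x D. (d x \<in> D) \<noteq> (e x \<in> D)"])
    have "disjoint_family_on (\<lambda>(i, j). cross (P i) (P j)) (index_pairs p)"
      using disj by (intro disjoint_family_cross) (auto simp: disjoint_family_on_def)
    then show "disjoint_family_on B (index_pairs p)"
      using sub unfolding disjoint_family_on_def by blast
    show "B x \<subseteq> all_edges n" if "x \<in> index_pairs p" for x
    proof -
      have "(\<lambda>(i, j). cross (P i) (P j)) x \<subseteq> all_edges n"
        using disj V that
        by (intro cross_family_subset_all_edges) (auto simp: disjoint_family_on_def)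
      then show ?thesis
        using sub[of x] by blast
    qed
    show "(0 - 1) * real (card {D \<in> Pow (B x). (d x \<in> D) \<noteq> (e x \<in> D)}) \<le> (0 - 1) * (1 / 2) * 2 ^ card (B x)"
      if x: "x \<in> index_pairs p" for x
    proof -
      have "{D \<in> Pow (B x). (d x \<in> D) \<noteq> (e x \<in> D)} = {{d x}, {e x}}"
        using ne[OF x] unfolding B_def by auto
      then show ?thesis
        using ne[OF x] unfolding B_def by simp
    qed
    show "1 \<le> 1 * (0::real) ^ card {x \<in> index_pairs p. (d x \<in> E \<inter> B x) \<noteq> (e x \<in> E \<inter> B x)}"
      if cp: "copied_subgraph p E w" for E
    proof -
      have none: "{x \<in> index_pairs p. (d x \<in> E \<inter> B x) \<noteq> (e x \<in> E \<inter> B x)} = {}"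
        using cp unfolding copied_subgraph_def B_def d_def e_def by auto
      show ?thesis
        unfolding none by simp
    qed
  qed (simp_all add: finite_all_edges finite_index_pairs)
  also have "\<dots> = (1 / 2) ^ (p choose 2) * 2 ^ card (all_edges n)"
    by (simp add: card_index_pairs)
  also have "\<dots> \<le> (9 / 10) ^ (p choose 2) * 2 ^ card (all_edges n)"
    by (intro mult_right_mono power_mono) auto
  finally show ?thesis .
qed (simp add: copied_subgraph_def)

subsection \<open>Typical graphs\<close>

text \<open>The first clause makes cut-continuous maps come from vertex maps; the two degree
  clauses, \<open>sparse_between\<close> and \<open>dense_on\<close> make these injective; the
  clause on differences and \<open>copied_subgraph\<close> exclude nontrivial automorphisms. The
  factor 3 is what the greedy choice of a set disjoint from its image uses up.\<close>

definition random_like :: "nat \<Rightarrow> nat \<Rightarrow> nat set set \<Rightarrow> bool" where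
  "random_like n p E \<longleftrightarrow>
    (\<forall>xs. set xs \<subseteq> {1..n} \<and> length xs = 5 \<longrightarrow> \<not> few_common_nbrs n E xs) \<and>
    (\<forall>s\<in>{1..n}. 5 * card (nbhd n E s) < 3 * n) \<and>
    (\<forall>u\<in>{1..n}. \<forall>v\<in>{1..n}. u \<noteq> v \<longrightarrow> 13 * n < 20 * card (nbhd n E u \<union> nbhd n E v)) \<and>
    (\<forall>u\<in>{1..n}. \<forall>v\<in>{1..n}. u \<noteq> v \<longrightarrow> 3 * p \<le> card (nbhd n E u - nbhd n E v)) \<and>
    (\<forall>w. w ` {..<2 * p} \<subseteq> {1..n} \<longrightarrow> \<not> sparse_between p E w) \<and>
    (\<forall>w. w ` {..<p} \<subseteq> {1..n} \<longrightarrow> \<not> dense_on p E w) \<and>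
    (\<forall>w. w ` {..<2 * p} \<subseteq> {1..n} \<longrightarrow> \<not> copied_subgraph p E w)"

text \<open>A union bound with one term for each of the first four clauses of
  \<open>random_like\<close>; the three clauses about tuples share the last term.\<close>

definition exceptional_bound :: "nat \<Rightarrow> nat \<Rightarrow> real" where
  "exceptional_bound n p = real n ^ 5 * (31 / 32) ^ (n - 5) + real n * (99 / 100) ^ n +
    real n ^ 2 * (3 * (99 / 100) ^ n) + real n ^ 2 * (8 ^ p * (7 / 8) ^ (n - 2)) +
    3 * (real n ^ (2 * p) * (9 / 10) ^ (p choose 2))"

section \<open>Union bounds over vertices and tuples\<close>

lemma card_Pow_union_bound:
  fixes b :: real
  assumes "finite U" "finite X" "\<And>x. x \<in> X \<Longrightarrow> real (card {E \<in> Pow U. P x E}) \<le> b * 2 ^ card U"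
  shows "real (card {E \<in> Pow U. \<exists>x\<in>X. P x E}) \<le> real (card X) * b * 2 ^ card U"
proof -
  have "{E \<in> Pow U. \<exists>x\<in>X. P x E} = (\<Union>x\<in>X. {E \<in> Pow U. P x E})"
    by auto
  then have "card {E \<in> Pow U. \<exists>x\<in>X. P x E} \<le> (\<Sum>x\<in>X. card {E \<in> Pow U. P x E})"
    using card_UN_le[OF assms(2), of "\<lambda>x. {E \<in> Pow U. P x E}"] by simp
  then have "real (card {E \<in> Pow U. \<exists>x\<in>X. P x E}) \<le> (\<Sum>x\<in>X. real (card {E \<in> Pow U. P x E}))"
    unfolding of_nat_sum[symmetric] of_nat_le_iff .
  also have "\<dots> \<le> (\<Sum>x\<in>X. b * 2 ^ card U)"
    by (intro sum_mono assms(3))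
  finally show ?thesis
    by simp
qed

text \<open>There are infinitely many functions \<open>w\<close>, but by \<open>cong\<close> only
  the restriction to \<open>{..<k}\<close> counts, which leaves \<open>card V ^ k\<close>
  cases.\<close>

lemma card_Pow_tuple_union_bound:
  fixes b :: real and P :: "(nat \<Rightarrow> 'b) \<Rightarrow> 'a set \<Rightarrow> bool"
  assumes U: "finite U" and V: "finite V"
    and b: "\<And>w. w ` {..<k} \<subseteq> V \<Longrightarrow> real (card {E \<in> Pow U. P w E}) \<le> b * 2 ^ card U"
    and cong: "\<And>w w' E. (\<And>i. i < k \<Longrightarrow> w i = w' i) \<Longrightarrow> P w E \<Longrightarrow> P w' E"
  shows "real (card {E \<in> Pow U. \<exists>w. w ` {..<k} \<subseteq> V \<and> P w E}) \<le> real (card V) ^ k * b * 2 ^ card U"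
proof -
  let ?X = "{..<k} \<rightarrow>\<^sub>E V"
  have "(\<exists>w. w ` {..<k} \<subseteq> V \<and> P w E) \<longleftrightarrow> (\<exists>w\<in>?X. P w E)" for E
  proof
    assume "\<exists>w. w ` {..<k} \<subseteq> V \<and> P w E"
    then obtain w where w: "w ` {..<k} \<subseteq> V" "P w E"
      by blast
    have "restrict w {..<k} \<in> ?X"
      using w(1) by auto
    moreover have "P (restrict w {..<k}) E"
      using cong[of w "restrict w {..<k}"] w(2) by simp
    ultimately show "\<exists>w\<in>?X. P w E"
      by blast
  next
    assume "\<exists>w\<in>?X. P w E"
    then show "\<exists>w. w ` {..<k} \<subseteq> V \<and> P w E"
      by (auto simp: PiE_iff image_subset_iff)
  qed
  then have "{E \<in> Pow U. \<exists>w. w ` {..<k} \<subseteq> V \<and> P w E} = {E \<in> Pow U. \<exists>w\<in>?X. P w E}"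
    by simp
  moreover have "real (card {E \<in> Pow U. \<exists>w\<in>?X. P w E}) \<le> real (card ?X) * b * 2 ^ card U"
    using U V b by (intro card_Pow_union_bound finite_PiE) (auto simp: PiE_iff image_subset_iff)
  ultimately show ?thesis
    by (simp add: card_PiE)
qed

lemma sparse_between_cong:
  assumes "\<And>i. i < 2 * p \<Longrightarrow> w i = w' i" "sparse_between p E w"
  shows "sparse_between p E w'"
proof -
  have "inj_on w' {..<2 * p} = inj_on w {..<2 * p}"
    using assms(1) by (intro inj_on_cong) simp
  moreover have "{(i, j) \<in> index_pairs p. E \<inter> cross {w' i, w' (p + i)} {w' j, w' (p + j)} = {}} =
      {(i, j) \<in> index_pairs p. E \<inter> cross {w i, w (p + i)} {w j, w (p + j)} = {}}"
    using assms(1) by (auto simp: index_pairs_def)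
  ultimately show ?thesis
    using assms(2) by (simp add: sparse_between_def)
qed

lemma dense_on_cong:
  assumes "\<And>i. i < p \<Longrightarrow> w i = w' i" "dense_on p E w"
  shows "dense_on p E w'"
proof -
  have "inj_on w' {..<p} = inj_on w {..<p}"
    using assms(1) by (intro inj_on_cong) simp
  moreover have "{(i, j) \<in> index_pairs p. {w' i, w' j} \<notin> E} = {(i, j) \<in> index_pairs p. {w i, w j} \<notin> E}"
    using assms(1) by (auto simp: index_pairs_def)
  ultimately show ?thesis
    using assms(2) by (simp add: dense_on_def)
qed

lemma copied_subgraph_cong:
  assumes "\<And>i. i < 2 * p \<Longrightarrow> w i = w' i" "copied_subgraph p E w"
  shows "copied_subgraph p E w'"
proof -
  have "inj_on w' {..<2 * p} = inj_on w {..<2 * p}"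
    using assms(1) by (intro inj_on_cong) simp
  then show ?thesis
    using assms by (auto simp: copied_subgraph_def index_pairs_def)
qed

lemma card_not_random_like_le:
  "real (card {E \<in> Pow (all_edges n). \<not> random_like n p E}) \<le> exceptional_bound n p * 2 ^ card (all_edges n)"
proof -
  let ?U = "all_edges n" and ?V = "{1..n}"
  let ?L = "{xs. set xs \<subseteq> ?V \<and> length xs = 5}" and ?D = "{(u, v) \<in> ?V \<times> ?V. u \<noteq> v}"
  let ?N = "\<lambda>P. {E \<in> Pow ?U. P E}"
  define A1 where "A1 = ?N (\<lambda>E. \<exists>xs\<in>?L. few_common_nbrs n E xs)"
  define A2 where "A2 = ?N (\<lambda>E. \<exists>s\<in>?V. 3 * n \<le> 5 * card (nbhd n E s))"
  define A3 where "A3 = ?N (\<lambda>E. \<exists>x\<in>?D. 20 * card (nbhd n E (fst x) \<union> nbhd n E (snd x)) \<le> 13 * n)"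
  define A4 where "A4 = ?N (\<lambda>E. \<exists>x\<in>?D. card (nbhd n E (fst x) - nbhd n E (snd x)) < 3 * p)"
  define A5 where "A5 = ?N (\<lambda>E. \<exists>w. w ` {..<2 * p} \<subseteq> ?V \<and> sparse_between p E w)"
  define A6 where "A6 = ?N (\<lambda>E. \<exists>w. w ` {..<p} \<subseteq> ?V \<and> dense_on p E w)"
  define A7 where "A7 = ?N (\<lambda>E. \<exists>w. w ` {..<2 * p} \<subseteq> ?V \<and> copied_subgraph p E w)"
  define q where "q = ((9 / 10) ^ (p choose 2) :: real)"
  define t where "t = (2 ^ card ?U :: real)"
  have D: "finite ?D" "real (card ?D) \<le> real n ^ 2"
  proof -
    show "finite ?D"
      by (rule finite_subset[of _ "?V \<times> ?V"]) auto
    have "card ?D \<le> card (?V \<times> ?V)"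
      by (rule card_mono) auto
    then have "card ?D \<le> n ^ 2"
      by (simp add: power2_eq_square)
    then show "real (card ?D) \<le> real n ^ 2"
      unfolding of_nat_power[symmetric] of_nat_le_iff .
  qed
  have finL: "finite ?L"
    using finite_lists_length_eq[of ?V 5] by simp
  have A1: "real (card A1) \<le> real n ^ 5 * (31 / 32) ^ (n - 5) * t"
    using card_Pow_union_bound[OF finite_all_edges finL, where P = "\<lambda>xs E. few_common_nbrs n E xs"]
      card_few_common_nbrs_le card_lists_length_eq[of ?V 5] unfolding A1_def t_def by simp
  have A2: "real (card A2) \<le> real n * (99 / 100) ^ n * t"
    using card_Pow_union_bound[OF finite_all_edges _ card_large_degree_le, of ?V] unfolding A2_def t_def by simp
  have "real (card A3) \<le> real (card ?D) * (3 * (99 / 100) ^ n) * t"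
    unfolding A3_def t_def by (rule card_Pow_union_bound[OF finite_all_edges D(1)])
      (use card_small_nbhd_Un_le in \<open>auto simp del: One_nat_def\<close>)
  also have "\<dots> \<le> real n ^ 2 * (3 * (99 / 100) ^ n) * t"
    using D(2) by (intro mult_right_mono) (simp_all add: t_def)
  finally have A3: "real (card A3) \<le> real n ^ 2 * (3 * (99 / 100) ^ n) * t" .
  have "real (card A4) \<le> real (card ?D) * (8 ^ p * (7 / 8) ^ (n - 2)) * t"
    unfolding A4_def t_def by (rule card_Pow_union_bound[OF finite_all_edges D(1)])
      (use card_small_nbhd_diff_le in \<open>auto simp del: One_nat_def\<close>)
  also have "\<dots> \<le> real n ^ 2 * (8 ^ p * (7 / 8) ^ (n - 2)) * t"
    using D(2) by (intro mult_right_mono) (simp_all add: t_def)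
  finally have A4: "real (card A4) \<le> real n ^ 2 * (8 ^ p * (7 / 8) ^ (n - 2)) * t" .
  have A5: "real (card A5) \<le> real (card ?V) ^ (2 * p) * q * t"
    unfolding A5_def q_def t_def
    by (rule card_Pow_tuple_union_bound[OF finite_all_edges _ card_sparse_between_le sparse_between_cong]) auto
  have "real (card A6) \<le> real (card ?V) ^ p * q * t"
    unfolding A6_def q_def t_def
    by (rule card_Pow_tuple_union_bound[OF finite_all_edges _ card_dense_on_le dense_on_cong]) auto
  also have "\<dots> \<le> real (card ?V) ^ (2 * p) * q * t"
  proof -
    have "real n ^ p \<le> real n ^ (2 * p)"
      by (cases "n = 0") (simp_all add: power_0_left power_increasing)
    then show ?thesis
      by (intro mult_right_mono) (simp_all add: q_def t_def)
  qed
  finally have A6: "real (card A6) \<le> real (card ?V) ^ (2 * p) * q * t" .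
  have A7: "real (card A7) \<le> real (card ?V) ^ (2 * p) * q * t"
    unfolding A7_def q_def t_def
    by (rule card_Pow_tuple_union_bound[OF finite_all_edges _ card_copied_subgraph_le copied_subgraph_cong]) auto
  have "E \<in> A1 \<union> (A2 \<union> (A3 \<union> (A4 \<union> (A5 \<union> (A6 \<union> A7)))))" if "E \<in> ?N (\<lambda>E. \<not> random_like n p E)" for E
    using that unfolding random_like_def A1_def A2_def A3_def A4_def A5_def A6_def A7_def
      de_Morgan_conj not_all not_imp not_less not_le Bex_def Ball_def not_not
    by (elim CollectE conjE disjE exE) (simp_all add: Bex_def del: One_nat_def, blast+)
  then have "?N (\<lambda>E. \<not> random_like n p E) \<subseteq> A1 \<union> (A2 \<union> (A3 \<union> (A4 \<union> (A5 \<union> (A6 \<union> A7)))))"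
    by (rule subsetI)
  then have "card (?N (\<lambda>E. \<not> random_like n p E)) \<le> card (A1 \<union> (A2 \<union> (A3 \<union> (A4 \<union> (A5 \<union> (A6 \<union> A7))))))"
    by (rule card_mono[rotated])
      (simp add: A1_def A2_def A3_def A4_def A5_def A6_def A7_def finite_all_edges)
  also have "\<dots> \<le> card A1 + (card A2 + (card A3 + (card A4 + (card A5 + (card A6 + card A7)))))"
    by (intro order_trans[OF card_Un_le] add_left_mono order_refl)
  finally have "real (card (?N (\<lambda>E. \<not> random_like n p E))) \<le>
      real (card A1) + (real (card A2) + (real (card A3) + (real (card A4) + (real (card A5) + (real (card A6) + real (card A7))))))"
    unfolding of_nat_add[symmetric] of_nat_le_iff .
  also have "\<dots> \<le> exceptional_bound n p * t"
    using A1 A2 A3 A4 A5 A6 A7 unfolding exceptional_bound_def q_def[symmetric] by (simp add: algebra_simps)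
  finally show ?thesis
    unfolding t_def .
qed

text \<open>With \<open>40 p\<^sup>2 \<le> n\<close> the gap \<open>n/20\<close> between the two degree bounds in \<open>random_like\<close> is at
  least \<open>2 p\<^sup>2\<close>.\<close>

definition tuple_len :: "nat \<Rightarrow> nat" where
  "tuple_len n = nat \<lfloor>sqrt (real n / 40)\<rfloor>"

lemma tuple_len_le: "40 * tuple_len n ^ 2 \<le> n"
proof -
  have "real (tuple_len n) \<le> sqrt (real n / 40)"
    unfolding tuple_len_def by simp
  then have "real (tuple_len n) ^ 2 \<le> real n / 40"
    by (metis of_nat_0_le_iff power_mono real_sqrt_pow2 divide_nonneg_nonneg zero_le_numeral)
  then have "real (40 * tuple_len n ^ 2) \<le> real n"
    by simp
  then show ?thesis
    by linarith
qed

lemma le_tuple_len_square: "real n \<le> 40 * (real (tuple_len n) + 1) ^ 2"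
proof -
  have "sqrt (real n / 40) \<le> real (tuple_len n) + 1"
    unfolding tuple_len_def by linarith
  then have "real n / 40 \<le> (real (tuple_len n) + 1) ^ 2"
    by (metis of_nat_0_le_iff power_mono real_sqrt_pow2 real_sqrt_ge_zero divide_nonneg_nonneg zero_le_numeral)
  then show ?thesis
    by simp
qed

lemma filterlim_tuple_len: "filterlim tuple_len at_top at_top"
  unfolding tuple_len_def by real_asymp

section \<open>Limits of the terms of the exceptional bound\<close>

lemma common_nbrs_term_tendsto_0: "(\<lambda>n. real n ^ 2 * (real n ^ 5 * (31 / 32) ^ (n - 5))) \<longlonglongrightarrow> 0"
\<comment> \<open>The shift by 5 removes the truncated subtraction from the exponent.\<close>
proof (rule LIMSEQ_offset[where k = 5])
  show "(\<lambda>n. real (n + 5) ^ 2 * (real (n + 5) ^ 5 * (31 / 32) ^ (n + 5 - 5))) \<longlonglongrightarrow> 0"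
    unfolding add_diff_cancel_right' by real_asymp
qed

lemma degree_term_tendsto_0: "(\<lambda>n. real n ^ 2 * (real n * (99 / 100) ^ n)) \<longlonglongrightarrow> 0"
  by real_asymp

lemma nbhd_Un_term_tendsto_0: "(\<lambda>n. real n ^ 2 * (real n ^ 2 * (3 * (99 / 100) ^ n))) \<longlonglongrightarrow> 0"
  by real_asymp

text \<open>As \<open>tuple_len n\<close> is of order \<open>sqrt n\<close>, the growing power of 8
  loses against the decaying power of 7/8.\<close>

lemma nbhd_diff_term_tendsto_0: "(\<lambda>n. real n ^ 2 * (real n ^ 2 * (8 ^ tuple_len n * (7 / 8) ^ (n - 2)))) \<longlonglongrightarrow> 0"
proof (rule tendsto_sandwich[OF _ _ tendsto_const])
  let ?g = "\<lambda>n. real n ^ 2 * (real n ^ 2 * (8 powr sqrt (real n / 40) * (7 / 8) powr (real n - 2)))"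
  show "eventually (\<lambda>n. 0 \<le> real n ^ 2 * (real n ^ 2 * (8 ^ tuple_len n * (7 / 8) ^ (n - 2)))) at_top"
    by simp
  show "eventually (\<lambda>n. real n ^ 2 * (real n ^ 2 * (8 ^ tuple_len n * (7 / 8) ^ (n - 2))) \<le> ?g n) at_top"
    using eventually_ge_at_top[of 2]
  proof eventually_elim
    case (elim n)
    have "(8::real) ^ tuple_len n = 8 powr real (tuple_len n)"
      by (simp add: powr_realpow)
    also have "\<dots> \<le> 8 powr sqrt (real n / 40)"
      unfolding tuple_len_def by (intro powr_mono) auto
    finally have "(8::real) ^ tuple_len n \<le> 8 powr sqrt (real n / 40)" .
    moreover have "(7 / 8) ^ (n - 2) = (7 / 8 :: real) powr (real n - 2)"
      using elim by (simp add: powr_realpow[symmetric] of_nat_diff)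
    ultimately show ?case
      by (intro mult_left_mono) simp_all
  qed
  show "?g \<longlonglongrightarrow> 0"
    by real_asymp
qed

lemma real_choose_two: "real (p choose 2) = real p * (real p - 1) / 2"
  by (cases p) (simp_all add: choose_two real_of_nat_div algebra_simps)

text \<open>By \<open>n \<le> 40 * (p + 1)^2\<close> with \<open>p = tuple_len n\<close>, the term
  is bounded by a function of \<open>p\<close> alone. There the number of tuples is exponential in
  \<open>p * ln p\<close>, while the probability decays exponentially in the square of
  \<open>p\<close>.\<close>

lemma tuple_term_tendsto_0: "(\<lambda>n. real n ^ 2 * (3 * (real n ^ (2 * tuple_len n) * (9 / 10) ^ (tuple_len n choose 2)))) \<longlonglongrightarrow> 0"
proof (rule tendsto_sandwich[OF _ _ tendsto_const])
  let ?h = "\<lambda>p. 3 * ((40 * (real p + 1) ^ 2) powr (2 * real p + 2) * (9 / 10) powr (real p * (real p - 1) / 2))"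
  show "eventually (\<lambda>n. 0 \<le> real n ^ 2 * (3 * (real n ^ (2 * tuple_len n) * (9 / 10) ^ (tuple_len n choose 2)))) at_top"
    by simp
  show "eventually (\<lambda>n. real n ^ 2 * (3 * (real n ^ (2 * tuple_len n) * (9 / 10) ^ (tuple_len n choose 2)))
      \<le> ?h (tuple_len n)) at_top"
  proof (rule always_eventually, rule allI)
    fix n
    let ?p = "tuple_len n"
    have "real n ^ 2 * real n ^ (2 * ?p) = real n ^ (2 * ?p + 2)"
      by (simp only: power_add mult.commute)
    also have "\<dots> \<le> (40 * (real ?p + 1) ^ 2) ^ (2 * ?p + 2)"
      by (intro power_mono le_tuple_len_square) simp
    also have "\<dots> = (40 * (real ?p + 1) ^ 2) powr real (2 * ?p + 2)"
      by (subst powr_realpow) (auto intro!: mult_pos_pos)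
    finally have "real n ^ 2 * real n ^ (2 * ?p) \<le> (40 * (real ?p + 1) ^ 2) powr (2 * real ?p + 2)"
      by (simp add: add.commute)
    moreover have "(9 / 10) ^ (?p choose 2) = (9 / 10 :: real) powr (real ?p * (real ?p - 1) / 2)"
      unfolding real_choose_two[symmetric] by (simp add: powr_realpow)
    ultimately show "real n ^ 2 * (3 * (real n ^ (2 * ?p) * (9 / 10) ^ (?p choose 2))) \<le> ?h ?p"
      by (simp add: mult_right_mono flip: mult.assoc)
  qed
  have "?h \<longlonglongrightarrow> 0"
    by real_asymp
  then show "(\<lambda>n. ?h (tuple_len n)) \<longlonglongrightarrow> 0"
    by (rule filterlim_compose[OF _ filterlim_tuple_len])
qed

lemma exceptional_bound_tendsto_0: "(\<lambda>n. real n ^ 2 * exceptional_bound n (tuple_len n)) \<longlonglongrightarrow> 0"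
  using tendsto_add[OF tendsto_add[OF tendsto_add[OF tendsto_add[OF common_nbrs_term_tendsto_0 degree_term_tendsto_0] nbhd_Un_term_tendsto_0] nbhd_diff_term_tendsto_0] tuple_term_tendsto_0]
  unfolding exceptional_bound_def by (simp add: distrib_left)

subsection \<open>Homomorphisms between typical graphs\<close>

lemma mem_cross_iff: "e \<in> cross A B \<longleftrightarrow> (\<exists>a\<in>A. \<exists>b\<in>B. e = {a, b})"
  unfolding cross_def by auto

text \<open>Either at least \<open>p\<close> fibres have two elements, each giving a pair, or a
  single fibre has \<open>2 * p\<close> elements. Otherwise fewer than \<open>p\<close> fibres are
  nontrivial and each has fewer than \<open>2 * p\<close> elements, so \<open>g\<close> loses less
  than \<open>2 * p^2\<close> elements of \<open>W\<close>.\<close>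

lemma collapsing_pairs:
  assumes W: "finite W" and collapse: "card (g ` W) + 2 * p\<^sup>2 \<le> card W"
  obtains w :: "nat \<Rightarrow> 'a" where "inj_on w {..<2 * p}" "w ` {..<2 * p} \<subseteq> W"
    "\<And>i. i < p \<Longrightarrow> g (w (p + i)) = g (w i)"
    "inj_on (g \<circ> w) {..<p} \<or> (\<forall>i<2 * p. \<forall>j<2 * p. g (w i) = g (w j))"
proof -
  define fib where "fib s = {x \<in> W. g x = s}" for s
  define T where "T = {s \<in> g ` W. 2 \<le> card (fib s)}"
  have fin: "finite (fib s)" "finite T" for s
    unfolding fib_def T_def using W by auto
  consider "p \<le> card T" | s where "2 * p \<le> card (fib s)" | "card T < p" "\<And>s. card (fib s) < 2 * p"
    by (meson not_le)
  then show thesis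
  proof cases
    case 1
    obtain T' where T': "T' \<subseteq> T" "card T' = p" "finite T'"
      using obtain_subset_with_card_n[OF 1] by metis
    then obtain s where s: "bij_betw s {..<p} T'"
      using ex_bij_betw_nat_finite[of T'] by (auto simp: lessThan_atLeast0)
    have "\<exists>a b. a \<in> fib t \<and> b \<in> fib t \<and> a \<noteq> b" if "t \<in> T" for t
    proof -
      have "Suc (Suc 0) \<le> card (fib t)"
        using that unfolding T_def by simp
      then show ?thesis
        unfolding card_le_Suc_iff by blast
    qed
    then obtain a b where ab: "\<And>t. t \<in> T \<Longrightarrow> a t \<in> fib t \<and> b t \<in> fib t \<and> a t \<noteq> b t"
      by metis
    \<comment> \<open>The first half lists one element of each chosen fibre and the second half its
      partner, so that \<open>r i\<close> below is the index of the fibre of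
      \<open>w i\<close>.\<close>
    define w where "w i = (if i < p then a (s i) else b (s (i - p)))" for i
    have sT: "s i \<in> T" if "i < p" for i
      using s T'(1) that bij_betwE by blast
    have s_inj: "s i = s j \<longleftrightarrow> i = j" if "i < p" "j < p" for i j
      using bij_betw_imp_inj_on[OF s] that by (simp add: inj_on_eq_iff)
    define r where "r i = (if i < p then i else i - p)" for i
    have r: "r i < p" if "i < 2 * p" for i
      using that unfolding r_def by auto
    have gw: "g (w i) = s (r i)" "w i \<in> W" if "i < 2 * p" for i
      using ab[OF sT, of i] ab[OF sT, of "i - p"] that unfolding w_def fib_def r_def by auto
    have "inj_on w {..<2 * p}"
    proof (rule inj_onI)
      fix i j assume ij: "i \<in> {..<2 * p}" "j \<in> {..<2 * p}" "w i = w j"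
      then have eq: "r i = r j"
        using gw(1)[of i] gw(1)[of j] s_inj[OF r r, of i j] by simp
      show "i = j"
      proof (rule ccontr)
        assume "i \<noteq> j"
        then have "(i < p \<and> j = p + i) \<or> (j < p \<and> i = p + j)"
          using eq unfolding r_def by (auto split: if_splits)
        then show False
          using ij(3) ab[OF sT, of i] ab[OF sT, of j] by (auto simp: w_def)
      qed
    qed
    moreover have "inj_on (g \<circ> w) {..<p}"
      using gw(1) s_inj by (intro inj_onI) (simp add: r_def)
    ultimately show thesis
      using gw by (intro that[of w]) (auto simp: r_def)
  next
    case (2 s)
    obtain T' where T': "T' \<subseteq> fib s" "card T' = 2 * p" "finite T'"
      using obtain_subset_with_card_n[OF 2] by metis
    then obtain w where w: "bij_betw w {..<2 * p} T'"
      using ex_bij_betw_nat_finite[of T'] by (auto simp: lessThan_atLeast0)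
    then have "w i \<in> fib s" if "i < 2 * p" for i
      using T'(1) that bij_betwE by blast
    then show thesis
      using w by (intro that[of w]) (auto simp: bij_betw_def fib_def)
  next
    case 3
    have "W = (\<Union>s\<in>g ` W. fib s)"
      unfolding fib_def by auto
    then have "card W \<le> (\<Sum>s\<in>g ` W. card (fib s))"
      using card_UN_le[of "g ` W" fib] W by simp
    also have "\<dots> \<le> (\<Sum>s\<in>g ` W. 1 + (if s \<in> T then 2 * p else 0))"
    proof (rule sum_mono)
      fix s assume "s \<in> g ` W"
      then show "card (fib s) \<le> 1 + (if s \<in> T then 2 * p else 0)"
        using 3(2)[of s] unfolding T_def by auto
    qed
    also have "\<dots> = card (g ` W) + card T * (2 * p)"
    proof -
      have "g ` W \<inter> T = T"
        unfolding T_def by blast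
      then show ?thesis
        unfolding sum.distrib using W by (simp add: sum.If_cases)
    qed
    also have "\<dots> < card (g ` W) + p * (2 * p)"
      using 3(1) by simp
    finally show thesis
      using collapse by (simp add: power2_eq_square)
  qed
qed

lemma hom_inj_on:
  assumes E: "E \<subseteq> all_edges n" and F: "F \<subseteq> all_edges n"
    and rE: "random_like n p E" and rF: "random_like n p F" and p: "40 * p\<^sup>2 \<le> n"
    and g: "g \<in> {1..n} \<rightarrow> {1..n}" and hom: "\<And>u v. {u, v} \<in> E \<Longrightarrow> {g u, g v} \<in> F"
  shows "inj_on g {1..n}"
proof (rule inj_onI, rule ccontr)
  fix u v assume uv: "u \<in> {1..n}" "v \<in> {1..n}" "g u = g v" "u \<noteq> v"
  let ?W = "nbhd n E u \<union> nbhd n E v"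
  have "g ` ?W \<subseteq> nbhd n F (g u)"
    using g hom uv unfolding nbhd_def by fastforce
  then have "card (g ` ?W) \<le> card (nbhd n F (g u))"
    by (intro card_mono) (auto simp: nbhd_def)
  moreover have "5 * card (nbhd n F (g u)) < 3 * n"
    using rF g uv(1) unfolding random_like_def by blast
  moreover have "13 * n < 20 * card ?W"
    using rE uv unfolding random_like_def by blast
  ultimately have "card (g ` ?W) + 2 * p\<^sup>2 \<le> card ?W"
    using p by linarith
  moreover have "finite ?W"
    by (simp add: nbhd_def)
  ultimately obtain w where w: "inj_on w {..<2 * p}" "w ` {..<2 * p} \<subseteq> ?W"
    "\<And>i. i < p \<Longrightarrow> g (w (p + i)) = g (w i)"
    "inj_on (g \<circ> w) {..<p} \<or> (\<forall>i<2 * p. \<forall>j<2 * p. g (w i) = g (w j))"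
    using collapsing_pairs by metis
  let ?X = "{(i, j) \<in> index_pairs p. E \<inter> cross {w i, w (p + i)} {w j, w (p + j)} = {}}"
  have wV: "w ` {..<2 * p} \<subseteq> {1..n}"
    using w(2) unfolding nbhd_def by blast
  then have "\<not> sparse_between p E w"
    using rE unfolding random_like_def by blast
  then have X: "4 * card ?X < p choose 2"
    using w(1) unfolding sparse_between_def by simp
  have edge: "{g (w i), g (w j)} \<in> F" if "(i, j) \<in> index_pairs p" "(i, j) \<notin> ?X" for i j
  proof -
    have ij: "i < p" "j < p"
      using that(1) unfolding index_pairs_def by auto
    have "E \<inter> cross {w i, w (p + i)} {w j, w (p + j)} \<noteq> {}"
      using that by blast
    then obtain e where e: "e \<in> E" "e \<in> cross {w i, w (p + i)} {w j, w (p + j)}"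
      by blast
    from e(2) obtain a b where "a \<in> {w i, w (p + i)}" "b \<in> {w j, w (p + j)}" "e = {a, b}"
      unfolding mem_cross_iff by (elim bexE)
    with e(1) have ab: "{a, b} \<in> E" "a \<in> {w i, w (p + i)}" "b \<in> {w j, w (p + j)}"
      by simp_all
    have "g a = g (w i)" "g b = g (w j)"
      using ab(2,3) w(3) ij by auto
    then show ?thesis
      using hom[OF ab(1)] by simp
  qed
  from w(4) show False
  proof
    assume inj: "inj_on (g \<circ> w) {..<p}"
    let ?Y = "{(i, j) \<in> index_pairs p. {(g \<circ> w) i, (g \<circ> w) j} \<notin> F}"
    have "(g \<circ> w) ` {..<p} \<subseteq> {1..n}"
      using wV g by (auto simp: image_subset_iff Pi_iff)
    then have "\<not> dense_on p F (g \<circ> w)"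
      using rF unfolding random_like_def by blast
    then have "p choose 2 < 4 * card ?Y"
      using inj unfolding dense_on_def by simp
    \<comment> \<open>A non-edge of the image can only come from two unjoined pairs, so more than a
      quarter of the pairs of pairs would be unjoined, against \<open>X\<close>.\<close>
    moreover have "card ?Y \<le> card ?X"
    proof (rule card_mono)
      show "finite ?X"
        by (rule finite_subset[OF _ finite_index_pairs[of p]]) auto
      show "?Y \<subseteq> ?X"
        using edge by auto
    qed
    ultimately show False
      using X by linarith
  next
    assume const: "\<forall>i<2 * p. \<forall>j<2 * p. g (w i) = g (w j)"
    \<comment> \<open>All \<open>w i\<close> have the same image, so an edge between two of the
      pairs would be mapped to a loop. Hence \<open>?X\<close> is everything, and \<open>X\<close>
      would say that \<open>4 * N < N\<close> for \<open>N = p choose 2\<close>.\<close>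
    have "(i, j) \<in> ?X" if ij: "(i, j) \<in> index_pairs p" for i j
    proof (rule ccontr)
      assume "(i, j) \<notin> ?X"
      then have "{g (w i), g (w j)} \<in> all_edges n"
        using edge[OF ij] F by blast
      moreover have "g (w i) = g (w j)"
        using const ij unfolding index_pairs_def by auto
      ultimately show False
        unfolding doubleton_in_all_edges by simp
    qed
    then have "?X = index_pairs p"
      by auto
    then show False
      using X by (simp add: card_index_pairs)
  qed
qed

text \<open>Greedy choice: every element \<open>x\<close> already chosen forbids at most three
  elements of \<open>D\<close>, namely \<open>x\<close>, \<open>g x\<close> and the preimage of
  \<open>x\<close>.\<close>

lemma obtain_set_disjoint_from_image:
  assumes "finite D" "inj_on g D" "\<And>x. x \<in> D \<Longrightarrow> g x \<noteq> x" "3 * k \<le> card D"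
  shows "\<exists>A\<subseteq>D. card A = k \<and> A \<inter> g ` A = {}"
  using assms(4)
proof (induction k)
  case 0
  then show ?case
    by (intro exI[of _ "{}"]) simp
next
  case (Suc k)
  then obtain A where A: "A \<subseteq> D" "card A = k" "A \<inter> g ` A = {}"
    by auto
  have fin: "finite A"
    using A(1) assms(1) finite_subset by blast
  let ?B = "{x \<in> D. g x \<in> A}"
  have "inj_on g ?B"
    using assms(2) by (rule inj_on_subset) blast
  then have "card ?B \<le> card A"
    using fin by (intro card_inj_on_le[of g]) auto
  moreover have "card (A \<union> g ` A \<union> ?B) \<le> card A + card (g ` A) + card ?B"
    by (meson add_right_mono card_Un_le order_trans)
  moreover have "card (g ` A) \<le> card A"
    using fin by (rule card_image_le)
  moreover have "3 * k < card D"
    using Suc.prems by simp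
  ultimately have "card (A \<union> g ` A \<union> ?B) < card D"
    using A(2) by linarith
  moreover have "finite (A \<union> g ` A \<union> ?B)"
    using fin assms(1) by simp
  ultimately obtain x where x: "x \<in> D" "x \<notin> A \<union> g ` A \<union> ?B"
    by (meson card_mono not_le subsetI)
  then have "insert x A \<subseteq> D" "card (insert x A) = Suc k" "insert x A \<inter> g ` insert x A = {}"
    using A fin assms(3)[of x] by auto
  then show ?case
    by blast
qed

lemma automorphism_trivial:
  assumes r: "random_like n p E" and g: "g \<in> {1..n} \<rightarrow> {1..n}" "inj_on g {1..n}"
    and aut: "\<And>u v. u \<in> {1..n} \<Longrightarrow> v \<in> {1..n} \<Longrightarrow> {u, v} \<in> E \<longleftrightarrow> {g u, g v} \<in> E"
    and v: "v \<in> {1..n}"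
  shows "g v = v"
proof (rule ccontr)
  assume ne: "g v \<noteq> v"
  have gv: "g v \<in> {1..n}"
    using g v by blast
  let ?D = "nbhd n E v - nbhd n E (g v)"
  have D: "?D \<subseteq> {1..n}"
    unfolding nbhd_def by blast
  have card: "3 * p \<le> card ?D"
    using r v gv ne unfolding random_like_def by (metis (no_types, lifting))
  \<comment> \<open>If \<open>x\<close> is adjacent to \<open>v\<close>, then \<open>g x\<close> is
    adjacent to \<open>g v\<close>; elements of \<open>?D\<close> are not.\<close>
  have moved: "g x \<noteq> x" if "x \<in> ?D" for x
    using that aut[of x v] v unfolding nbhd_def by auto
  obtain A where A: "A \<subseteq> ?D" "card A = p" "A \<inter> g ` A = {}"
    using obtain_set_disjoint_from_image[OF _ inj_on_subset[OF g(2) D] moved card]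
    finite_subset[OF D] by auto
  have AV: "A \<subseteq> {1..n}" "finite A"
    using A(1) D finite_subset[of A "{1..n}"] by auto
  obtain s where s: "bij_betw s {..<p} A"
    using ex_bij_betw_nat_finite[OF AV(2)] A(2) by (auto simp: lessThan_atLeast0)
  have sA: "s i \<in> A" if "i < p" for i
    using s that bij_betwE by blast
  have s_inj: "s i = s j \<longleftrightarrow> i = j" if "i < p" "j < p" for i j
    using bij_betw_imp_inj_on[OF s] that by (simp add: inj_on_eq_iff)
  have gs_inj: "g (s i) = g (s j) \<longleftrightarrow> i = j" if "i < p" "j < p" for i j
    using g(2) sA[OF that(1)] sA[OF that(2)] AV(1) s_inj[OF that] by (metis inj_on_eq_iff subsetD)
  have s_ne: "s i \<noteq> g (s j)" if "i < p" "j < p" for i j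
    using A(3) sA[OF that(1)] sA[OF that(2)] by blast
  define w where "w i = (if i < p then s i else g (s (i - p)))" for i
  have "inj_on w {..<2 * p}"
  proof (rule inj_onI)
    fix i j assume ij: "i \<in> {..<2 * p}" "j \<in> {..<2 * p}" "w i = w j"
    have "i - p < p" "j - p < p"
      using ij(1,2) by auto
    then show "i = j"
      using ij(3) s_inj[of i j] gs_inj[of "i - p" "j - p"] s_ne[of i "j - p"] s_ne[of j "i - p"]
      by (cases "i < p"; cases "j < p") (auto simp: w_def)
  qed
  moreover have "{w i, w j} \<in> E \<longleftrightarrow> {w (p + i), w (p + j)} \<in> E" if "(i, j) \<in> index_pairs p" for i j
  proof -
    have ij: "i < p" "j < p"
      using that unfolding index_pairs_def by auto
    then have "s i \<in> {1..n}" "s j \<in> {1..n}"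
      using sA AV(1) by blast+
    from aut[OF this] show ?thesis
      using ij by (simp add: w_def)
  qed
  ultimately have "copied_subgraph p E w"
    unfolding copied_subgraph_def by blast
  moreover have "w ` {..<2 * p} \<subseteq> {1..n}"
  proof (rule image_subsetI)
    fix i assume "i \<in> {..<2 * p}"
    then have "i - p < p"
      by auto
    then show "w i \<in> {1..n}"
      using sA[of i] sA[of "i - p"] AV(1) g(1) unfolding w_def by (cases "i < p") auto
  qed
  ultimately show False
    using r unfolding random_like_def by blast
qed

lemma simple_graph_all_edges: "E \<subseteq> all_edges n \<Longrightarrow> simple_graph ({1..n}, E)"
  unfolding simple_graph_def all_edges_def by auto

text \<open>The map is induced by a homomorphism \<open>g\<close>, which \<open>hom_inj_on\<close>
  makes injective. So \<open>g\<close> is injective on edges too, and the equal numbers of edges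
  make it onto \<open>F\<close>.\<close>

lemma cut_continuous_isomorphism:
  assumes E: "E \<subseteq> all_edges n" and F: "F \<subseteq> all_edges n"
    and rE: "random_like n p E" and rF: "random_like n p F" and p: "40 * p\<^sup>2 \<le> n"
    and card: "card E = card F" and f: "cut_continuous ({1..n}, E) ({1..n}, F) f"
  obtains g where "bij_betw g {1..n} {1..n}" "F = (`) g ` E" "\<And>e. e \<in> E \<Longrightarrow> f e = g ` e"
proof -
  have ext: "\<exists>x. \<forall>a\<in>set xs. {x, a} \<in> edges ({1..n}, E)"
    if "set xs \<subseteq> verts ({1..n}, E)" "length xs = 5" for xs
  proof -
    have "\<not> few_common_nbrs n E xs"
      using rE that unfolding random_like_def by simp
    then show ?thesis
      unfolding few_common_nbrs_def by auto
  qed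
  obtain g where g: "g \<in> {1..n} \<rightarrow> {1..n}"
    and gf: "\<And>u v. {u, v} \<in> E \<Longrightarrow> g u \<noteq> g v \<and> f {u, v} = {g u, g v}"
    using cut_continuous_induced[OF simple_graph_all_edges[OF E] simple_graph_all_edges[OF F] f ext]
    by (metis fst_conv snd_conv)
  have pair: "\<exists>a b. e = {a, b}" if "e \<in> E" for e
  proof -
    have "card e = 2"
      using that E unfolding all_edges_def by blast
    then show ?thesis
      by (meson card_2_iff)
  qed
  have fE: "f e \<in> F" if "e \<in> E" for e
    using f that unfolding cut_continuous_def by auto
  have fg: "f e = g ` e" if "e \<in> E" for e
    using pair[OF that] gf that by auto
  have "{g u, g v} \<in> F" if "{u, v} \<in> E" for u v
    using gf[OF that] fE[OF that] by simp
  then have inj: "inj_on g {1..n}"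
    by (rule hom_inj_on[OF E F rE rF p g])
  have "inj_on ((`) g) E"
    using inj_on_image_Pow[OF inj] by (rule inj_on_subset) (use E in \<open>auto simp: all_edges_def\<close>)
  then have "card ((`) g ` E) = card F"
    using card by (simp add: card_image)
  moreover have "(`) g ` E \<subseteq> F"
    using fE fg by auto
  ultimately have "(`) g ` E = F"
    using F finite_all_edges finite_subset by (intro card_subset_eq) blast+
  moreover have "bij_betw g {1..n} {1..n}"
    using inj g endo_inj_surj[of "{1..n}" g] unfolding bij_betw_def by auto
  ultimately show thesis
    using that fg by blast
qed

lemma random_like_TT_rigid:
  assumes E: "E \<subseteq> all_edges n" and r: "random_like n p E" and p: "40 * p\<^sup>2 \<le> n"
  shows "TT_rigid ({1..n}, E)"
  unfolding TT_rigid_def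
proof (intro allI impI ballI)
  fix f e assume f: "cut_continuous ({1..n}, E) ({1..n}, E) f" and e: "e \<in> edges ({1..n}, E)"
  obtain g where g: "bij_betw g {1..n} {1..n}" "E = (`) g ` E" "\<And>e. e \<in> E \<Longrightarrow> f e = g ` e"
    using cut_continuous_isomorphism[OF E E r r p refl f] by metis
  have inj: "inj_on g {1..n}" and gV: "g \<in> {1..n} \<rightarrow> {1..n}"
    using g(1) bij_betwE[OF g(1)] unfolding bij_betw_def by auto
  have eV: "d \<subseteq> {1..n}" if "d \<in> E" for d
    using E that unfolding all_edges_def by blast
  have aut: "{u, v} \<in> E \<longleftrightarrow> {g u, g v} \<in> E" if uv: "u \<in> {1..n}" "v \<in> {1..n}" for u v
  proof
    assume "{u, v} \<in> E"
    then have "g ` {u, v} \<in> E"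
      by (subst g(2)) (rule imageI)
    then show "{g u, g v} \<in> E"
      by simp
  next
    assume "{g u, g v} \<in> E"
    then have "g ` {u, v} \<in> (`) g ` E"
      unfolding g(2)[symmetric] by simp
    then obtain d where d: "d \<in> E" "g ` d = g ` {u, v}"
      by force
    then have "d = {u, v}"
      using inj_on_image_eq_iff[OF inj eV[OF d(1)], of "{u, v}"] uv by simp
    then show "{u, v} \<in> E"
      using d(1) by simp
  qed
  have "g v = v" if "v \<in> {1..n}" for v
    by (rule automorphism_trivial[OF r gV inj aut that])
  then have "g ` e = e"
    using eV[of e] e by (force simp: image_iff)
  then show "f e = e"
    using g(3) e by simp
qed

subsection \<open>Rigidity and incomparability\<close>

lemma graphs_on_eq_all_edges: "graphs_on n = Pair {1..n} ` Pow (all_edges n)"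
  unfolding graphs_on_eq all_edges_def by auto

lemma prob_TT_rigid_ge:
  "1 - exceptional_bound n (tuple_len n) \<le> measure_pmf.prob (random_graph n) {G. TT_rigid G}"
proof -
  let ?U = "all_edges n" and ?R = "random_like n (tuple_len n)"
  have fin: "finite (Pow ?U)"
    using finite_all_edges by simp
  have cardG: "card (graphs_on n) = 2 ^ card ?U"
    by (simp add: card_graphs_on card_all_edges)
  have "Pair {1..n} ` {E \<in> Pow ?U. ?R E} \<subseteq> graphs_on n \<inter> {G. TT_rigid G}"
    using random_like_TT_rigid[OF _ _ tuple_len_le] unfolding graphs_on_eq_all_edges by auto
  then have "card (Pair {1..n} ` {E \<in> Pow ?U. ?R E}) \<le> card (graphs_on n \<inter> {G. TT_rigid G})"
    using finite_graphs_on by (intro card_mono) auto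
  then have "card {E \<in> Pow ?U. ?R E} \<le> card (graphs_on n \<inter> {G. TT_rigid G})"
    by (simp add: card_image inj_on_def)
  moreover have "card {E \<in> Pow ?U. ?R E} + card {E \<in> Pow ?U. \<not> ?R E} = card (Pow ?U)"
    using fin by (subst card_Un_disjoint[symmetric]) (auto intro!: arg_cong[where f = card])
  then have "real (card {E \<in> Pow ?U. ?R E}) + real (card {E \<in> Pow ?U. \<not> ?R E}) = 2 ^ card ?U"
    unfolding of_nat_add[symmetric] by (simp add: card_Pow finite_all_edges)
  ultimately have "2 ^ card ?U - real (card {E \<in> Pow ?U. \<not> ?R E}) \<le> real (card (graphs_on n \<inter> {G. TT_rigid G}))"
    by linarith
  then have "(1 - exceptional_bound n (tuple_len n)) * 2 ^ card ?U \<le> real (card (graphs_on n \<inter> {G. TT_rigid G}))"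
    using card_not_random_like_le[of n "tuple_len n"] by (simp add: algebra_simps)
  then show ?thesis
    unfolding random_graph_def measure_pmf_of_set[OF graphs_on_nonempty finite_graphs_on] cardG
    by (simp add: le_divide_eq)
qed

lemma exceptional_bound_nonneg: "0 \<le> exceptional_bound n p"
  unfolding exceptional_bound_def by (intro add_nonneg_nonneg mult_nonneg_nonneg) auto

lemma choose_two_le_square: "0 < n \<Longrightarrow> real (n choose 2) + 1 \<le> real n ^ 2"
proof -
  assume "0 < n"
  then have "1 \<le> real n"
    by simp
  \<comment> \<open>This product is twice the difference of the two sides of the claim.\<close>
  then have "0 \<le> (real n - 1) * (real n + 2)"
    by (intro mult_nonneg_nonneg) auto
  then show ?thesis
    unfolding real_choose_two by (simp add: power2_eq_square field_simps)
qed

text \<open>The first factor turns a fraction of all graphs into a fraction of those with half of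
  the possible edges. For \<open>n < 40\<close> the tuple length is 0 and the last term of
  \<open>exceptional_bound\<close> equals 3, so the error exceeds 1 and the bound on the family is
  trivial.\<close>

definition family_error :: "nat \<Rightarrow> real" where
  "family_error n = (real (n choose 2) + 1) * exceptional_bound n (tuple_len n)"

lemma family_error_tendsto_0: "family_error \<longlonglongrightarrow> 0"
proof (rule tendsto_sandwich[OF _ _ tendsto_const exceptional_bound_tendsto_0])
  show "\<forall>\<^sub>F n in sequentially. 0 \<le> family_error n"
    unfolding family_error_def using exceptional_bound_nonneg by simp
  show "\<forall>\<^sub>F n in sequentially. family_error n \<le> real n ^ 2 * exceptional_bound n (tuple_len n)"
    using eventually_gt_at_top[of 0]
  proof eventually_elim
    case (elim n)
    then show ?case
      unfolding family_error_def by (intro mult_right_mono choose_two_le_square exceptional_bound_nonneg)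
  qed
qed

lemma prob_TT_rigid_tendsto_1: "(\<lambda>n. measure_pmf.prob (random_graph n) {G. TT_rigid G}) \<longlonglongrightarrow> 1"
proof (rule tendsto_sandwich[OF _ _ _ tendsto_const])
  show "\<forall>\<^sub>F n in sequentially. 1 - family_error n \<le> measure_pmf.prob (random_graph n) {G. TT_rigid G}"
  proof (rule always_eventually, rule allI)
    fix n
    have "exceptional_bound n (tuple_len n) \<le> family_error n"
      unfolding family_error_def using exceptional_bound_nonneg[of n "tuple_len n"]
      by (simp add: distrib_right)
    then show "1 - family_error n \<le> measure_pmf.prob (random_graph n) {G. TT_rigid G}"
      using prob_TT_rigid_ge[of n] by linarith
  qed
  show "(\<lambda>n. 1 - family_error n) \<longlonglongrightarrow> 1"
    using tendsto_diff[OF tendsto_const family_error_tendsto_0, of 1] by simp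
qed (simp_all add: measure_pmf.prob_le_1)

section \<open>Representatives of isomorphism classes\<close>

lemma equiv_representatives:
  assumes A: "finite A" and r: "equiv A r" and k: "\<And>x. x \<in> A \<Longrightarrow> card (r `` {x}) \<le> k"
  obtains R where "R \<subseteq> A" "card A \<le> card R * k" "\<And>x y. x \<in> R \<Longrightarrow> y \<in> R \<Longrightarrow> (x, y) \<in> r \<Longrightarrow> x = y"
proof -
  have "\<exists>x. x \<in> c" if "c \<in> A // r" for c
    using in_quotient_imp_non_empty[OF r that] by blast
  then obtain f where f: "\<And>c. c \<in> A // r \<Longrightarrow> f c \<in> c"
    by metis
  have same: "c = d" if "c \<in> A // r" "d \<in> A // r" "(f c, f d) \<in> r" for c d
    using quotient_eqI[OF r that(1,2) f[OF that(1)] f[OF that(2)] that(3)] .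
  have refl: "(f c, f c) \<in> r" if "c \<in> A // r" for c
    using in_quotient_imp_in_rel[OF r that] f[OF that] by blast
  have "card A = card (\<Union>(A // r))"
    using Union_quotient[OF r] by simp
  also have "\<dots> \<le> (\<Sum>c\<in>A // r. card c)"
    using finite_quotient[OF A] card_UN_le[of "A // r" id] r A
    by (simp add: equiv_type)
  also have "\<dots> \<le> (\<Sum>c\<in>A // r. k)"
    using k by (intro sum_mono) (auto elim: quotientE)
  also have "\<dots> = card (f ` (A // r)) * k"
    using same refl by (subst card_image) (auto simp: inj_on_def)
  finally show thesis
    using that[of "f ` (A // r)"] same f in_quotient_imp_subset[OF r] by blast
qed

text \<open>An isomorphism class has at most \<open>fact n\<close> members. All graphs in
  \<open>A\<close> have the same number of edges, so a cut-continuous map between two of them forces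
  an isomorphism, and representatives of different classes are incomparable.\<close>

lemma obtain_incomparable_rigid_family:
  obtains F where "F \<subseteq> graphs_on n"
    "1 / fact n * real ((n choose 2) choose ((n choose 2) div 2)) * (1 - family_error n) \<le> real (card F)"
    "\<And>G. G \<in> F \<Longrightarrow> TT_rigid G" "pairwise TT_incomparable F"
proof -
  let ?U = "all_edges n" and ?p = "tuple_len n" and ?N = "n choose 2"
  let ?C = "?N choose (?N div 2)"
  define A where "A = {E \<in> Pow ?U. card E = ?N div 2 \<and> random_like n ?p E}"
  define r where "r = {(E, F). E \<in> A \<and> F \<in> A \<and> (\<exists>\<pi>. \<pi> permutes {1..n} \<and> F = (`) \<pi> ` E)}"
  have finA: "finite A"
    unfolding A_def using finite_all_edges by simp
  have "equiv A r"
  proof (rule equivI)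
    show "r \<subseteq> A \<times> A"
      unfolding r_def by blast
    show "refl_on A r"
    proof (rule refl_onI)
      fix E assume "E \<in> A"
      then show "(E, E) \<in> r"
        using permutes_id[of "{1..n}"] unfolding r_def by (auto intro!: exI[of _ id])
    qed
    show "sym r"
    proof (rule symI)
      fix E F assume "(E, F) \<in> r"
      then obtain \<pi> where \<pi>: "E \<in> A" "F \<in> A" "\<pi> permutes {1..n}" "F = (`) \<pi> ` E"
        unfolding r_def by blast
      have "(`) (inv \<pi>) ` F = E"
        unfolding \<pi>(4) by (simp add: image_image permutes_inverses(2)[OF \<pi>(3)])
      then show "(F, E) \<in> r"
        using \<pi> permutes_inv[OF \<pi>(3)] unfolding r_def by blast
    qed
    show "trans r"
    proof (rule transI)
      fix D E F assume "(D, E) \<in> r" "(E, F) \<in> r"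
      then obtain \<pi> \<sigma> where *: "D \<in> A" "F \<in> A" "\<pi> permutes {1..n}" "E = (`) \<pi> ` D"
        "\<sigma> permutes {1..n}" "F = (`) \<sigma> ` E"
        unfolding r_def by blast
      have "F = (`) (\<sigma> \<circ> \<pi>) ` D"
        unfolding *(4,6) by (simp add: image_image image_comp)
      then show "(D, F) \<in> r"
        using * permutes_compose[OF *(3,5)] unfolding r_def by blast
    qed
  qed
  moreover have "card (r `` {E}) \<le> fact n" for E
  proof -
    have "r `` {E} \<subseteq> (\<lambda>\<pi>. (`) \<pi> ` E) ` {\<pi>. \<pi> permutes {1..n}}"
      unfolding r_def by blast
    then show ?thesis
      using card_permutations[of "{1..n}" n] surj_card_le[OF finite_permutations[of "{1..n}"]] by simp
  qed
  ultimately obtain R where R: "R \<subseteq> A" "card A \<le> card R * fact n"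
    "\<And>E F. E \<in> R \<Longrightarrow> F \<in> R \<Longrightarrow> (E, F) \<in> r \<Longrightarrow> E = F"
    using equiv_representatives[OF finA, of r "fact n"] by metis
  have iso: "E = F" if EF: "E \<in> R" "F \<in> R" and f: "cut_continuous ({1..n}, E) ({1..n}, F) f" for E F f
  proof -
    have A: "E \<in> A" "F \<in> A"
      using EF R(1) by auto
    then have "E \<subseteq> ?U" "F \<subseteq> ?U" "random_like n ?p E" "random_like n ?p F" "card E = card F"
      unfolding A_def by auto
    from cut_continuous_isomorphism[OF this(1-4) tuple_len_le this(5) f] obtain g
      where g: "bij_betw g {1..n} {1..n}" "F = (`) g ` E"
      by metis
    \<comment> \<open>Only the values of \<open>g\<close> on \<open>{1..n}\<close> are controlled,
      while a permutation in the sense of \<open>permutes\<close> has to fix all other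
      numbers.\<close>
    define \<pi> where "\<pi> x = (if x \<in> {1..n} then g x else x)" for x
    have "bij_betw \<pi> {1..n} {1..n}"
      using g(1) by (subst bij_betw_cong[of _ _ g]) (auto simp: \<pi>_def)
    then have "\<pi> permutes {1..n}"
      by (rule bij_imp_permutes) (auto simp: \<pi>_def)
    moreover have "F = (`) \<pi> ` E"
    proof -
      have "\<pi> ` e = g ` e" if "e \<in> E" for e
      proof (rule image_cong[OF refl])
        fix x assume "x \<in> e"
        then have "x \<in> {1..n}"
          using that \<open>E \<subseteq> ?U\<close> unfolding all_edges_def by blast
        then show "\<pi> x = g x"
          by (simp add: \<pi>_def)
      qed
      then show ?thesis
        unfolding g(2) by (rule image_cong[OF refl, symmetric])
    qed
    ultimately show ?thesis
      using R(3)[OF EF] A unfolding r_def by blast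
  qed
  have "card {E \<in> Pow ?U. card E = ?N div 2} = ?C"
    using n_subsets[OF finite_all_edges[of n], of "?N div 2"] by (simp add: card_all_edges)
  moreover have "{E \<in> Pow ?U. card E = ?N div 2} \<subseteq> A \<union> {E \<in> Pow ?U. \<not> random_like n ?p E}"
    unfolding A_def by blast
  then have "card {E \<in> Pow ?U. card E = ?N div 2} \<le> card A + card {E \<in> Pow ?U. \<not> random_like n ?p E}"
    using finA finite_all_edges by (intro order_trans[OF card_mono card_Un_le]) simp_all
  ultimately have "real ?C \<le> real (card A) + real (card {E \<in> Pow ?U. \<not> random_like n ?p E})"
    by linarith
  also have "\<dots> \<le> real (card A) + exceptional_bound n ?p * 2 ^ ?N"
    using card_not_random_like_le[of n ?p] by (simp add: card_all_edges)
  \<comment> \<open>The middle binomial coefficient is the largest of the \<open>?N + 1\<close>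
    summands of \<open>2 ^ ?N\<close>.\<close>
  also have "\<dots> \<le> real (card A) + exceptional_bound n ?p * ((real ?N + 1) * real ?C)"
  proof -
    have "(2::nat) ^ ?N = (\<Sum>k\<le>?N. ?N choose k)"
      by (simp add: choose_row_sum)
    also have "\<dots> \<le> (\<Sum>k\<le>?N. ?C)"
      by (intro sum_mono binomial_maximum)
    finally have "(2::nat) ^ ?N \<le> (?N + 1) * ?C"
      by simp
    then have "real (2 ^ ?N) \<le> real ((?N + 1) * ?C)"
      by (rule of_nat_mono)
    then have "2 ^ ?N \<le> (real ?N + 1) * real ?C"
      by (simp add: algebra_simps)
    then show ?thesis
      by (intro add_left_mono mult_left_mono exceptional_bound_nonneg)
  qed
  finally have "real ?C * (1 - family_error n) \<le> real (card A)"
    unfolding family_error_def by (simp add: algebra_simps)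
  also have "\<dots> \<le> real (card R * fact n)"
    using R(2) by (rule of_nat_mono)
  finally have "real ?C * (1 - family_error n) \<le> real (card R) * fact n"
    by simp
  then have "1 / fact n * real ?C * (1 - family_error n) \<le> real (card R)"
    by (simp add: divide_le_eq mult.commute)
  moreover have "card (Pair {1..n} ` R) = card R"
    by (simp add: card_image inj_on_def)
  ultimately have "1 / fact n * real ?C * (1 - family_error n) \<le> real (card (Pair {1..n} ` R))"
    by simp
  moreover have "Pair {1..n} ` R \<subseteq> graphs_on n"
    using R(1) unfolding graphs_on_eq_all_edges A_def by blast
  moreover have "TT_rigid G" if "G \<in> Pair {1..n} ` R" for G
    using that R(1) random_like_TT_rigid[OF _ _ tuple_len_le] unfolding A_def by blast
  moreover have "pairwise TT_incomparable (Pair {1..n} ` R)"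
    unfolding pairwise_def TT_incomparable_def using iso by blast
  ultimately show thesis
    using that by blast
qed

theorem corollary6:
  shows "(\<lambda>n. measure_pmf.prob (random_graph n) {G. TT_rigid G}) \<longlonglongrightarrow> 1
    \<and> (\<exists>\<epsilon> :: nat \<Rightarrow> real. \<epsilon> \<longlonglongrightarrow> 0 \<and>
         (\<forall>n. \<exists>F \<subseteq> graphs_on n.
            real (card F) \<ge> 1 / fact n * real ((n choose 2) choose ((n choose 2) div 2)) * (1 - \<epsilon> n) \<and>
            (\<forall>G\<in>F. TT_rigid G) \<and>
            pairwise TT_incomparable F))"
  using prob_TT_rigid_tendsto_1 family_error_tendsto_0 obtain_incomparable_rigid_family by metis

end
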